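(* Let $f$ be a discrete Morse-Bott function on a Lefschetz complex $\mathbb{K}$. Then the remainder series $R_t(\mathbb{K},f)$ has nonnegative integer coefficients and satisfies $$\sum_{C\in\mathcal{C}_f}P_t(C)=P_t(\mathbb{K})+(1+t)R_t(\mathbb{K},f),$$ where $\mathcal{C}_f$ denotes the collection of (nonempty) weakly critical sets of $f$.
   Context: A Lefschetz complex is a triple $\mathbb{K}=(X,\dim,w)$, where $X$ is a set (its elements are called cells), $\dim\colon X\to\mathbb{Z}_{\ge0}$ and $w\colon X\times X\to\mathbb{R}$ are functions, $\dim^{-1}(k)$ is finite for every $k\in\mathbb{Z}_{\ge0}$, and: (L1) $w(\tau,\sigma)\neq0$ implies $\dim\tau-\dim\sigma=1$; (L2) $\sum_{\sigma\in X}w(\tau,\sigma)w(\sigma,\nu)=0$ for all $\tau,\nu\in X$. We write $\sigma\in\mathbb{K}$ for $\sigma\in X$; a cell of dimension $k$ is called a $k$-cell. (No finiteness of $X$ itself is assumed.) A subset $A\subset X$ is a subcomplex if $(A,\dim|_A,w|_{A\times A})$ is a Lefschetz complex. Homology: $C_k(\mathbb{K})$ is the real vector space with basis the $k$-cells, $C_{-1}(\mathbb{K})=\{0\}$, $\partial_k\colon C_k(\mathbb{K})\to C_{k-1}(\mathbb{K})$ is the linear map with $\partial_k(\tau)=\sum_{\sigma}w(\tau,\sigma)\sigma$ (sum over $(k-1)$-cells). Put $Z_k(\mathbb{K})=\ker\partial_k$, $B_k(\mathbb{K})=\operatorname{im}\partial_{k+1}$, $H_k(\mathbb{K})=Z_k(\mathbb{K})/B_k(\mathbb{K})$,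 $b_k^{\mathbb{K}}=\operatorname{rank}H_k(\mathbb{K})$ (rank means real dimension), and $P_t(\mathbb{K})=\sum_{k\ge0}b_k^{\mathbb{K}}t^k$, a formal power series. For a function $f\colon\mathbb{K}\to\mathbb{R}$ on the cells and $\sigma\in\mathbb{K}$ put $U^{\mathrm{snc}}(\sigma)=\#\{\tau\in\mathbb{K}\mid w(\tau,\sigma)\ne0,\ f(\sigma)>f(\tau)\}$ and $D^{\mathrm{snc}}(\sigma)=\#\{\nu\in\mathbb{K}\mid w(\sigma,\nu)\ne0,\ f(\sigma)<f(\nu)\}$. The function $f$ is a discrete Morse-Bott function if $U^{\mathrm{snc}}(\sigma)\le1$ and $D^{\mathrm{snc}}(\sigma)\le1$ for every cell $\sigma$. A level set of $f$ is a nonempty set $L=\{\sigma\in\mathbb{K}\mid f(\sigma)=r\}$, $r\in\mathbb{R}$; the set $\{\sigma\in L\mid U^{\mathrm{snc}}(\sigma)+D^{\mathrm{snc}}(\sigma)=0\}$ is called a weakly critical set, and $\mathcal{C}_f$ is the family of all nonempty weakly critical sets. For $f$ discrete Morse-Bott each $C\in\mathcal{C}_f$ is a subcomplex of $\mathbb{K}$, and $P_t(C)$ denotes the Poincaré series of the Lefschetz complex $(C,\dim|_C,w|_{C\times C})$. The sum over $\mathcal{C}_f$ is taken coefficientwise (in each degree only finitely many terms are nonzero). The weakly critical complex $\mathbb{W}(\mathbb{K},f)$ is the disjoint union of the Lefschetz complexes $(C,\dim|_C,w|_{C\times C})$, $C\in\mathcal{C}_f$: its cells are the cells with $U^{\mathrm{snc}}=D^{\mathrm{snc}}=0$,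 and its incidence function is $w(\tau,\sigma)$ if $f(\tau)=f(\sigma)$ and $0$ otherwise. With $d_k^{\mathrm{snc}}(\mathbb{K},f)=\#\{k\text{-cells }\sigma\mid D^{\mathrm{snc}}(\sigma)=1\}$, the remainder series is $$R_t(\mathbb{K},f)=\sum_{k=1}^\infty\bigl(\operatorname{rank}B_{k-1}(\mathbb{K})-d_k^{\mathrm{snc}}(\mathbb{K},f)-\operatorname{rank}B_{k-1}(\mathbb{W}(\mathbb{K},f))\bigr)t^{k-1}.$$ *)

theory Defs
  imports
    "HOL-Analysis.Analysis"
    "HOL-Analysis.Finite_Function_Topology"
    "HOL-Computational_Algebra.Formal_Power_Series"
    "Jordan_Normal_Form.Missing_VectorSpace"
begin

section \<open>Lefschetz complexes\<close>

text \<open>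
  Only the values of the three fields on cells are meaningful; every notion below evaluates
  \<open>cell_dim\<close> and \<open>incidence\<close> on cells only.
\<close>

record 'a lefschetz =
  cells :: "'a set"
  cell_dim :: "'a \<Rightarrow> nat"
  incidence :: "'a \<Rightarrow> 'a \<Rightarrow> real"

definition k_cells :: "'a lefschetz \<Rightarrow> nat \<Rightarrow> 'a set" where
  "k_cells K k = {\<sigma> \<in> cells K. cell_dim K \<sigma> = k}"

text \<open>
  The set of cells may be infinite, whereas \<open>sum\<close> over an infinite set is \<open>0\<close> by convention.
  The sum in \<open>incidence_square\<close> therefore runs over the support of \<open>incidence K \<tau>\<close>,
  which is finite by the first two axioms.
\<close>

locale lefschetz_complex =
  fixes K :: "'a lefschetz"
  assumes finite_k_cells: "finite (k_cells K k)"
    and incidence_dim: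
      "\<lbrakk>\<tau> \<in> cells K; \<sigma> \<in> cells K; incidence K \<tau> \<sigma> \<noteq> 0\<rbrakk>
        \<Longrightarrow> int (cell_dim K \<tau>) - int (cell_dim K \<sigma>) = 1"
    and incidence_square:
      "\<lbrakk>\<tau> \<in> cells K; \<nu> \<in> cells K\<rbrakk>
        \<Longrightarrow> (\<Sum>\<sigma> | \<sigma> \<in> cells K \<and> incidence K \<tau> \<sigma> \<noteq> 0.
              incidence K \<tau> \<sigma> * incidence K \<sigma> \<nu>) = 0"

definition restrict_cells :: "'a lefschetz \<Rightarrow> 'a set \<Rightarrow> 'a lefschetz" where
  "restrict_cells K A = K\<lparr>cells := A\<rparr>"


section \<open>Homology\<close>

definition chains :: "'a lefschetz \<Rightarrow> nat \<Rightarrow> ('a \<Rightarrow>\<^sub>0 real) set" where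
  "chains K k = {c. Poly_Mapping.keys c \<subseteq> k_cells K k}"

text \<open>
  The inner sum is over the cells of dimension \<open>k - 1\<close>. It is empty for \<open>k = 0\<close>,
  so that \<open>boundary K 0 = 0\<close>, in accordance with the convention that the space of
  \<open>(-1)\<close>-chains is zero.
\<close>

definition boundary :: "'a lefschetz \<Rightarrow> nat \<Rightarrow> ('a \<Rightarrow>\<^sub>0 real) \<Rightarrow> ('a \<Rightarrow>\<^sub>0 real)" where
  "boundary K k c =
     (\<Sum>\<tau>\<in>k_cells K k. Poly_Mapping.lookup c \<tau> *\<^sub>R
        (\<Sum>\<sigma> | \<sigma> \<in> cells K \<and> cell_dim K \<sigma> + 1 = k. Poly_Mapping.single \<sigma> (incidence K \<tau> \<sigma>)))"

definition cycles :: "'a lefschetz \<Rightarrow> nat \<Rightarrow> ('a \<Rightarrow>\<^sub>0 real) set" where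
  "cycles K k = {c \<in> chains K k. boundary K k c = 0}"

definition boundaries :: "'a lefschetz \<Rightarrow> nat \<Rightarrow> ('a \<Rightarrow>\<^sub>0 real) set" where
  "boundaries K k = boundary K (k + 1) ` chains K (k + 1)"

definition real_scalars :: "real ring" where
  "real_scalars = \<lparr>carrier = UNIV, mult = (*), one = 1, zero = 0, add = (+)\<rparr>"

text \<open>
  The quotient \<open>V / W\<close> of real vector spaces \<open>W \<subseteq> V\<close>; its elements are cosets of \<open>W\<close>.
  The fields \<open>mult\<close> and \<open>one\<close> are inherited from the ring record and play no role in modules.
  Adding \<open>W\<close> in the scalar multiplication matters only for the scalar \<open>0\<close>.
\<close>

definition quotient_space :: "'v::real_vector set \<Rightarrow> 'v set \<Rightarrow> (real, 'v set) module" where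
  "quotient_space V W =
     \<lparr>carrier = {{v + w | w. w \<in> W} | v. v \<in> V},
      mult = undefined, one = undefined,
      zero = W,
      add = (\<lambda>A B. {a + b | a b. a \<in> A \<and> b \<in> B}),
      smult = (\<lambda>r A. {r *\<^sub>R a + w | a w. a \<in> A \<and> w \<in> W})\<rparr>"

lemma real_scalars_field: "field real_scalars"
  unfolding real_scalars_def
  apply unfold_locales
  apply (auto simp: field_simps Units_def)
  subgoal for x by (rule exI[of _ "-x"]) simp
  subgoal for x by (rule exI[of _ "1/x"]) simp
  done

lemma quotient_space_vectorspace:
  fixes V W :: "'v::real_vector set"
  assumes V: "real_vector.subspace V" and W: "real_vector.subspace W" and sub: "W \<subseteq> V"
  shows "vectorspace real_scalars (quotient_space V W)"
proof -
  interpret F: field real_scalars by (rule real_scalars_field)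
  define c where "c v = {v + w | w. w \<in> W}" for v
  have add: "{a + b | a b. a \<in> c u \<and> b \<in> c v} = c (u + v)" for u v
  proof -
    have "\<exists>a b. x = a + b \<and> a \<in> c u \<and> b \<in> c v" if "w \<in> W" "x = u + v + w" for x w
      using that real_vector.subspace_0[OF W] unfolding c_def
      by (intro exI[of _ "u + w"] exI[of _ v]) auto
    moreover have "u + a + (v + b) = u + v + (a + b)" for a b by simp
    ultimately show ?thesis unfolding c_def
      using real_vector.subspace_add[OF W] by (auto simp: c_def)
  qed
  have scale: "{r *\<^sub>R a + w | a w. a \<in> c u \<and> w \<in> W} = c (r *\<^sub>R u)" for r u
  proof -
    have "\<exists>w''. r *\<^sub>R (u + w) + w' = r *\<^sub>R u + w'' \<and> w'' \<in> W" if "w \<in> W" "w' \<in> W" for w w'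
      using that by (intro exI[of _ "r *\<^sub>R w + w'"])
        (auto simp: algebra_simps intro!: real_vector.subspace_add[OF W] real_vector.subspace_scale[OF W])
    moreover have "u \<in> c u" unfolding c_def using real_vector.subspace_0[OF W] by force
    ultimately show ?thesis unfolding c_def by auto (use \<open>u \<in> c u\<close> c_def in blast)
  qed
  have zero: "W = c 0" by (auto simp: c_def)
  define pl where "pl = (\<lambda>A B. {a + b | a b. a \<in> A \<and> (b::'v) \<in> B})"
  define sm where "sm = (\<lambda>r A. {r *\<^sub>R a + w | a w. a \<in> A \<and> w \<in> W})"
  have pl: "pl (c u) (c v) = c (u + v)" for u v using add by (simp add: pl_def)
  have sm: "sm r (c u) = c (r *\<^sub>R u)" for r u using scale by (simp add: sm_def)
  have Q: "quotient_space V W = \<lparr>carrier = c ` V, mult = undefined, one = undefined, zero = c 0,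
     add = pl, smult = sm\<rparr>"
    unfolding quotient_space_def pl_def sm_def using zero by (auto simp: c_def)
  have "\<exists>y\<in>V. c (x + y) = c 0" if "x \<in> V" for x
    using real_vector.subspace_neg[OF V that] by (intro bexI[of _ "- x"]) auto
  then show ?thesis
    using real_vector.subspace_0[OF V] real_vector.subspace_add[OF V] real_vector.subspace_scale[OF V]
    by (intro vs_criteria F.field_axioms; simp add: Q)
      (auto simp: pl sm real_scalars_def algebra_simps)
qed

definition homology :: "'a lefschetz \<Rightarrow> nat \<Rightarrow> (real, ('a \<Rightarrow>\<^sub>0 real) set) module" where
  "homology K k = quotient_space (cycles K k) (boundaries K k)"

definition betti :: "'a lefschetz \<Rightarrow> nat \<Rightarrow> nat" where
  "betti K k = vectorspace.dim real_scalars (homology K k)"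

text \<open>
  Families of power series, even infinite ones, are summed coefficientwise by \<open>has_sum\<close> for the
  library's topology on \<open>int fps\<close>; it includes that in each degree only finitely many
  terms are nonzero (\<open>has_sum_fpsI\<close>, \<open>has_sum_fpsD\<close>).
\<close>

definition poincare_series :: "'a lefschetz \<Rightarrow> int fps" where
  "poincare_series K = Abs_fps (\<lambda>k. int (betti K k))"


section \<open>Discrete Morse-Bott functions\<close>

definition U_snc :: "'a lefschetz \<Rightarrow> ('a \<Rightarrow> real) \<Rightarrow> 'a \<Rightarrow> nat" where
  "U_snc K f \<sigma> = card {\<tau> \<in> cells K. incidence K \<tau> \<sigma> \<noteq> 0 \<and> f \<sigma> > f \<tau>}"

definition D_snc :: "'a lefschetz \<Rightarrow> ('a \<Rightarrow> real) \<Rightarrow> 'a \<Rightarrow> nat" where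
  "D_snc K f \<sigma> = card {\<nu> \<in> cells K. incidence K \<sigma> \<nu> \<noteq> 0 \<and> f \<sigma> < f \<nu>}"

definition discrete_morse_bott :: "'a lefschetz \<Rightarrow> ('a \<Rightarrow> real) \<Rightarrow> bool" where
  "discrete_morse_bott K f \<longleftrightarrow> (\<forall>\<sigma>\<in>cells K. U_snc K f \<sigma> \<le> 1 \<and> D_snc K f \<sigma> \<le> 1)"

definition level_sets :: "'a lefschetz \<Rightarrow> ('a \<Rightarrow> real) \<Rightarrow> 'a set set" where
  "level_sets K f = {L. L \<noteq> {} \<and> (\<exists>r. L = {\<sigma> \<in> cells K. f \<sigma> = r})}"

definition weakly_critical_set :: "'a lefschetz \<Rightarrow> ('a \<Rightarrow> real) \<Rightarrow> 'a set \<Rightarrow> 'a set" where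
  "weakly_critical_set K f L = {\<sigma> \<in> L. U_snc K f \<sigma> + D_snc K f \<sigma> = 0}"

definition weakly_critical_sets :: "'a lefschetz \<Rightarrow> ('a \<Rightarrow> real) \<Rightarrow> 'a set set" where
  "weakly_critical_sets K f = weakly_critical_set K f ` level_sets K f - {{}}"

definition weakly_critical_complex :: "'a lefschetz \<Rightarrow> ('a \<Rightarrow> real) \<Rightarrow> 'a lefschetz" where
  "weakly_critical_complex K f =
     \<lparr>cells = {\<sigma> \<in> cells K. U_snc K f \<sigma> = 0 \<and> D_snc K f \<sigma> = 0},
      cell_dim = cell_dim K,
      incidence = (\<lambda>\<tau> \<sigma>. if f \<tau> = f \<sigma> then incidence K \<tau> \<sigma> else 0)\<rparr>"

definition d_snc :: "'a lefschetz \<Rightarrow> ('a \<Rightarrow> real) \<Rightarrow> nat \<Rightarrow> nat" where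
  "d_snc K f k = card {\<sigma> \<in> k_cells K k. D_snc K f \<sigma> = 1}"

text \<open>
  The series \<open>\<Sum>k\<ge>1. (rank B\<^bsub>k-1\<^esub>(K) - d\<^sub>k - rank B\<^bsub>k-1\<^esub>(W)) t\<^bsup>k-1\<^esup>\<close>, indexed by \<open>j = k - 1\<close>,
  where \<open>W\<close> is the weakly critical complex.
\<close>

definition remainder_series :: "'a lefschetz \<Rightarrow> ('a \<Rightarrow> real) \<Rightarrow> int fps" where
  "remainder_series K f =
     Abs_fps (\<lambda>j. int (real_vector.dim (boundaries K j)) - int (d_snc K f (j + 1))
       - int (real_vector.dim (boundaries (weakly_critical_complex K f) j)))"

end

theory Submission
  imports Defs
begin

text \<open>
  Let \<open>W\<close> be the weakly critical complex of \<open>f\<close>.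
  For a Lefschetz complex let \<open>n\<^sub>k\<close> be the number of \<open>k\<close>-cells and \<open>r\<^sub>k\<close> the rank of the boundary
  map on \<open>k\<close>-chains. Rank-nullity gives \<open>b\<^sub>k = n\<^sub>k - r\<^sub>k - r\<^bsub>k+1\<^esub>\<close> (\<open>betti_plus_ranks\<close>), so that both
  sides of the identity become statements about numbers of cells and ranks of matrices.

  A cell \<open>\<sigma>\<close> with \<open>D\<^sup>s\<^sup>n\<^sup>c(\<sigma>) = 1\<close> has exactly one face on which \<open>f\<close> is larger than at \<open>\<sigma>\<close>; call it
  the partner of \<open>\<sigma>\<close>. The axiom \<open>\<Sum>\<^sub>\<sigma> w(\<tau>,\<sigma>) w(\<sigma>,\<nu>) = 0\<close>
  never leaves a single nonzero product \<open>w(\<tau>,\<sigma>) w(\<sigma>,\<nu>)\<close>: with one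
  path \<open>\<tau>, \<sigma>, \<nu>\<close> there is a second one through another middle cell (\<open>other_middle_cell\<close>).
  Together with the bounds \<open>U\<^sup>s\<^sup>n\<^sup>c, D\<^sup>s\<^sup>n\<^sup>c \<le> 1\<close> this forces that no cell has both \<open>U\<^sup>s\<^sup>n\<^sup>c = 1\<close> and
  \<open>D\<^sup>s\<^sup>n\<^sup>c = 1\<close>. Hence the cells that are not weakly critical are perfectly matched in pairs, and
  \<open>n\<^sub>k(K) = n\<^sub>k(W) + d\<^sub>k + d\<^bsub>k+1\<^esub>\<close> (\<open>card_k_cells\<close>). Inserting this into the formula for \<open>b\<^sub>k\<close> yields
  \<open>P\<^sub>t(W) = P\<^sub>t(K) + (1 + t) R\<^sub>t\<close>. The same second-path argument shows that the middle cell of a path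
  between weakly critical cells of one level is a weakly critical cell of that level, which makes
  \<open>W\<close> and the weakly critical sets \<open>C\<close> Lefschetz complexes. The boundary matrix of \<open>W\<close> is block diagonal with the
  sets \<open>C\<close> as blocks, so \<open>P\<^sub>t(W)\<close> is the sum of the series \<open>P\<^sub>t(C)\<close>.

  Nonnegativity of \<open>R\<^sub>t\<close> is the inequality \<open>r\<^sub>k(K) \<ge> d\<^sub>k + r\<^sub>k(W)\<close> (\<open>boundary_rank_ge\<close>). In the
  boundary matrix of \<open>K\<close> keep the rows of the weakly critical cells and of the cells with
  \<open>D\<^sup>s\<^sup>n\<^sup>c = 1\<close>, and the columns of the weakly critical cells and of the partners. Sort the rows by the
  value of \<open>f\<close>, and give a partner column the value of \<open>f\<close> at its row. The resulting matrix
  is block triangular. The diagonal block of a level is itself block triangular: its blocks are the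
  boundary matrix of the weakly critical set of that level and a diagonal matrix with
  nonzero entries, one for each pair. The rank of a block triangular matrix is at
  least the sum of the ranks of its diagonal blocks (\<open>submatrix_rank_block_triangular\<close>).
\<close>

section \<open>Finite-dimensional subspaces of a real vector space\<close>

lemma finite_basis_exists:
  fixes V :: "'v::real_vector set"
  assumes "finite B" "V \<subseteq> span B"
  obtains C where "finite C" "C \<subseteq> V" "independent C" "V \<subseteq> span C" "card C = dim V"
proof -
  obtain C where "C \<subseteq> V" "independent C" "V \<subseteq> span C" "card C = dim V"
    using real_vector.basis_exists by blast
  with that assms real_vector.independent_span_bound[of B C] show ?thesis by blast
qed

lemma dim_mono_of_finite_span:
  fixes U V :: "'v::real_vector set"
  assumes B: "finite B" "V \<subseteq> span B" and "U \<subseteq> V"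
  shows "dim U \<le> dim V"
proof -
  obtain C where "finite C" "V \<subseteq> span C" "card C = dim V"
    by (rule finite_basis_exists[OF B])
  with \<open>U \<subseteq> V\<close> show ?thesis
    using real_vector.dim_le_card[of U C] by (metis order_trans)
qed

text \<open>
  The ambient space is arbitrary, since chain spaces lie inside the infinite-dimensional space of
  all finitely supported functions; finiteness of the dimension is a hypothesis on \<open>V\<close> alone.
  A basis of the kernel is extended to a basis of \<open>V\<close>, and \<open>T\<close> is injective on the span of the
  added vectors.
\<close>

lemma rank_nullity:
  fixes T :: "'v::real_vector \<Rightarrow> 'w::real_vector"
  assumes T: "linear T" and V: "real_vector.subspace V" and B: "finite B" "V \<subseteq> span B"
  shows "dim V = dim (T ` V) + dim {x \<in> V. T x = 0}"
proof -
  interpret T: linear T by fact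
  define N where "N = {x \<in> V. T x = 0}"
  have NV: "N \<subseteq> V" by (auto simp: N_def)
  obtain C where C: "C \<subseteq> N" "independent C" "N \<subseteq> span C" "card C = dim N"
    using real_vector.basis_exists by blast
  obtain D where D: "C \<subseteq> D" "D \<subseteq> V" "independent D" "V \<subseteq> span D"
    using real_vector.maximal_independent_subset_extend[of C V] C NV by blast
  have finD: "finite D"
    using real_vector.independent_span_bound[of B D] D B by blast
  have indep: "independent (D - C)"
    using D(3) by (rule real_vector.independent_mono) auto
  have spanV: "span (D - C) \<subseteq> V"
    using D(2) V by (intro real_vector.span_minimal) auto
  \<comment> \<open>Such an \<open>x\<close> has its \<open>D\<close>-coordinates supported both in \<open>C\<close> and in \<open>D - C\<close>.\<close>
  have zero: "x = 0" if x: "x \<in> span (D - C)" "T x = 0" for x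
  proof (rule ccontr)
    assume "x \<noteq> 0"
    have "x \<in> span C" using x spanV C(3) by (auto simp: N_def)
    then have "representation D x b = 0" if "b \<notin> C" for b
      using real_vector.representation_extend[OF D(3) _ D(1), of x] that
        real_vector.representation_ne_zero[of C x b] by auto
    moreover have "representation D x b = 0" if "b \<in> C" for b
      using real_vector.representation_extend[OF D(3) x(1), of] that
        real_vector.representation_ne_zero[of "D - C" x b] by auto
    ultimately have "representation D x b = 0" for b by blast
    then show False
      using real_vector.sum_nonzero_representation_eq[OF D(3), of x] x(1) \<open>x \<noteq> 0\<close>
        real_vector.span_mono[of "D - C" D] by auto
  qed
  have inj: "inj_on T (span (D - C))"
  proof (rule inj_onI)
    fix x y assume "x \<in> span (D - C)" "y \<in> span (D - C)" "T x = T y"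
    then have "x - y = 0" by (intro zero) (auto simp: T.diff real_vector.span_diff)
    then show "x = y" by simp
  qed
  have "T ` V \<subseteq> span (T ` (D - C))"
  proof -
    have "T ` V \<subseteq> span (T ` D)"
      using D(4) linear_span_image[OF T, of D] by auto
    moreover have "T ` D \<subseteq> insert 0 (T ` (D - C))"
      using C(1) by (auto simp: N_def)
    ultimately show ?thesis
      using real_vector.span_mono[of "T ` D" "insert 0 (T ` (D - C))"] by auto
  qed
  moreover have "independent (T ` (D - C))"
    using linear_independent_injective_image[OF T indep inj] .
  ultimately have "dim (T ` V) = card (T ` (D - C))"
    using D(2) by (intro real_vector.dim_unique[of "T ` (D - C)"]) auto
  also have "\<dots> = card (D - C)"
    using inj_on_subset[OF inj real_vector.span_superset] by (rule card_image)
  also have "\<dots> = card D - card C"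
    using D(1) finD by (meson card_Diff_subset finite_subset)
  finally have "dim (T ` V) = card D - card C" .
  moreover have "card C \<le> card D" using D(1) finD by (rule card_mono[rotated])
  moreover have "dim V = card D"
    using real_vector.dim_unique[OF D(2,4,3) refl] .
  ultimately show ?thesis using C(4) unfolding N_def by linarith
qed


section \<open>Dimension of a quotient space\<close>

definition coset :: "'v::real_vector set \<Rightarrow> 'v \<Rightarrow> 'v set" where
  "coset W v = {v + w | w. w \<in> W}"

context
  fixes W :: "'v::real_vector set"
  assumes W: "real_vector.subspace W"
begin

lemma coset_self: "v \<in> coset W v"
  using real_vector.subspace_0[OF W] by (force simp: coset_def)

lemma coset_eq_iff: "coset W u = coset W v \<longleftrightarrow> u - v \<in> W"
proof
  assume "coset W u = coset W v"
  then show "u - v \<in> W" using coset_self[of u] by (auto simp: coset_def)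
next
  have sub: "coset W x \<subseteq> coset W y" if xy: "x - y \<in> W" for x y
  proof -
    have "x + w = y + (x - y + w)" "x - y + w \<in> W" if "w \<in> W" for w
      using that xy real_vector.subspace_add[OF W] by auto
    then show ?thesis unfolding coset_def by blast
  qed
  assume "u - v \<in> W"
  then have "v - u \<in> W" using real_vector.subspace_neg[OF W] by fastforce
  with \<open>u - v \<in> W\<close> show "coset W u = coset W v" using sub by blast
qed

lemma add_coset: "{a + b | a b. a \<in> coset W u \<and> b \<in> coset W v} = coset W (u + v)"
proof -
  have "\<exists>a b. u + v + w = a + b \<and> a \<in> coset W u \<and> b \<in> coset W v" if "w \<in> W" for w
    using that coset_self by (intro exI[of _ "u + w"] exI[of _ v]) (auto simp: coset_def)
  moreover have "u + w + (v + w') = u + v + (w + w')" for w w' by simp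
  ultimately show ?thesis
    using real_vector.subspace_add[OF W] unfolding coset_def by blast
qed

lemma scale_coset: "{r *\<^sub>R a + w | a w. a \<in> coset W v \<and> w \<in> W} = coset W (r *\<^sub>R v)"
proof -
  have "r *\<^sub>R (v + w) + w' = r *\<^sub>R v + (r *\<^sub>R w + w')" for w w' by (simp add: scaleR_add_right)
  then show ?thesis
    using coset_self real_vector.subspace_add[OF W] real_vector.subspace_scale[OF W]
    unfolding coset_def by fastforce
qed

lemma carrier_quotient_space: "carrier (quotient_space V W) = coset W ` V"
  by (auto simp: quotient_space_def coset_def)

lemma zero_quotient_space: "\<zero>\<^bsub>quotient_space V W\<^esub> = coset W 0"
  by (auto simp: quotient_space_def coset_def)

lemma add_quotient_space:
  "coset W u \<oplus>\<^bsub>quotient_space V W\<^esub> coset W v = coset W (u + v)"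
  using add_coset by (simp add: quotient_space_def)

lemma smult_quotient_space:
  "r \<odot>\<^bsub>quotient_space V W\<^esub> coset W v = coset W (r *\<^sub>R v)"
  using scale_coset by (simp add: quotient_space_def)

text \<open>
  The dimension is the least size of a generating set, so both inequalities come from moving
  generators between \<open>V / W\<close> and \<open>V\<close>: a basis of \<open>V\<close> that extends one of \<open>W\<close> gives
  generators of the quotient, and representatives of generators of the quotient generate \<open>V\<close>
  together with a basis of \<open>W\<close>.
\<close>

lemma dim_quotient_space:
  assumes V: "real_vector.subspace V" and WV: "W \<subseteq> V" and B: "finite B" "V \<subseteq> span B"
  shows "vectorspace.dim real_scalars (quotient_space V W) + dim W = dim V"
proof -
  let ?Q = "quotient_space V W"
  interpret Q: vectorspace real_scalars ?Q
    by (rule quotient_space_vectorspace[OF V W WV])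
  note ops = zero_quotient_space add_quotient_space smult_quotient_space
  obtain C where C: "finite C" "C \<subseteq> W" "independent C" "W \<subseteq> span C" "card C = dim W"
    by (rule finite_basis_exists[OF B(1) order_trans[OF WV B(2)]])
  obtain D where D: "C \<subseteq> D" "D \<subseteq> V" "independent D" "V \<subseteq> span D"
    using real_vector.maximal_independent_subset_extend[of C V] C WV by blast
  have finD: "finite D"
    using real_vector.independent_span_bound[of B D] D B by blast
  have dimV: "dim V = card D"
    using real_vector.dim_unique[OF D(2,4,3) refl] .
  define A where "A = coset W ` (D - C)"
  have A: "finite A" "A \<subseteq> carrier ?Q"
    using finD D(2) by (auto simp: A_def carrier_quotient_space)
  interpret S: submodule real_scalars "Q.span A" ?Q
    using A(2) by (rule Q.span_is_submodule)
  have "coset W v \<in> Q.span A" if "v \<in> span D" for v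
    using that
  proof (induction rule: real_vector.span_induct_alt)
    case base
    then show ?case using S.zero_closed by (simp add: ops)
  next
    case (step r x y)
    have "coset W x \<in> Q.span A"
    proof (cases "x \<in> C")
      case True
      then have "coset W x = coset W 0" using C(2) coset_eq_iff by auto
      then show ?thesis using S.zero_closed by (simp add: ops)
    next
      case False
      with step have "coset W x \<in> A" by (auto simp: A_def)
      then show ?thesis using Q.in_own_span[OF A(2)] by blast
    qed
    then have "r \<odot>\<^bsub>?Q\<^esub> coset W x \<in> Q.span A"
      by (intro S.smult_closed) (auto simp: real_scalars_def)
    then show ?case using S.m_closed[of "coset W (r *\<^sub>R x)" "coset W y"] step by (simp add: ops)
  qed
  then have gen: "Q.span A = carrier ?Q"
    using D(4) Q.span_is_subset2[OF A(2)] by (auto simp: carrier_quotient_space)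
  have le: "Q.dim \<le> card A"
    unfolding Q.dim_def by (rule Least_le) (use A gen in blast)
  have "\<exists>A'. finite A' \<and> card A' = Q.dim \<and> A' \<subseteq> carrier ?Q \<and> Q.span A' = carrier ?Q"
    unfolding Q.dim_def by (rule LeastI_ex) (use A gen in blast)
  then obtain A' where A': "finite A'" "card A' = Q.dim" "A' \<subseteq> carrier ?Q" "Q.span A' = carrier ?Q"
    by blast
  obtain E where E: "E \<subseteq> V" "A' = coset W ` E" "inj_on (coset W) E"
    using A'(3) by (metis carrier_quotient_space subset_image_inj)
  have finE: "finite E" "card E = Q.dim"
    using E A' by (auto simp: card_image finite_image_iff)
  let ?U = "span (E \<union> C)"
  have UV: "?U \<subseteq> V"
    using E(1) C(2) WV V by (intro real_vector.span_minimal) auto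
  have "submodule real_scalars (coset W ` ?U) ?Q"
  proof
    show "coset W ` ?U \<subseteq> carrier ?Q" using UV by (auto simp: carrier_quotient_space)
  qed (auto simp: ops real_vector.span_add real_vector.span_scale real_vector.span_zero intro!: imageI)
  then have "Q.span A' \<subseteq> coset W ` ?U"
    using E(2) real_vector.span_superset[of "E \<union> C"] by (intro Q.span_is_subset) auto
  have "V \<subseteq> ?U"
  proof
    fix v assume "v \<in> V"
    then have "coset W v \<in> coset W ` ?U"
      using \<open>Q.span A' \<subseteq> _\<close> A'(4) by (auto simp: carrier_quotient_space)
    then obtain u where u: "u \<in> ?U" "v - u \<in> W" using coset_eq_iff by blast
    then have "v - u \<in> ?U" using C(4) real_vector.span_mono[of C "E \<union> C"] by blast
    from real_vector.span_add[OF this u(1)] show "v \<in> ?U" by simp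
  qed
  then have "dim V \<le> card (E \<union> C)" using finE C by (intro real_vector.dim_le_card) auto
  also have "\<dots> \<le> Q.dim + dim W" using card_Un_le[of E C] finE C by simp
  finally have "dim V \<le> Q.dim + dim W" .
  moreover have "Q.dim + dim W \<le> dim V"
  proof -
    have "card A \<le> card (D - C)" unfolding A_def using finD by (intro card_image_le) auto
    also have "\<dots> = card D - card C" using C(1) D(1) by (rule card_Diff_subset)
    finally show ?thesis
      using le C(5) dimV card_mono[OF finD D(1)] by linarith
  qed
  ultimately show ?thesis by simp
qed

end


section \<open>Ranks of block triangular matrices\<close>

lemma lookup_scaleR [simp]:
  fixes x :: "'b \<Rightarrow>\<^sub>0 'v::real_vector"
  shows "Poly_Mapping.lookup (r *\<^sub>R x) i = r *\<^sub>R Poly_Mapping.lookup x i"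
proof -
  have "finite {i. r *\<^sub>R Poly_Mapping.lookup x i \<noteq> 0}"
    by (rule finite_subset[OF _ finite_lookup[of x]]) auto
  then show ?thesis by (simp add: scaleR_poly_mapping_def Abs_poly_mapping_inverse)
qed

lemma dim_linear_image_le:
  fixes T :: "'v::real_vector \<Rightarrow> 'w::real_vector"
  assumes "linear T" "finite X"
  shows "dim (T ` X) \<le> dim X"
proof -
  have "dim (span X) = dim (T ` span X) + dim {x \<in> span X. T x = 0}"
    using assms by (intro rank_nullity[where B = X]) auto
  then show ?thesis using linear_span_image[OF assms(1), of X] by (metis le_add1 real_vector.dim_span)
qed

lemma dim_Un_le:
  fixes X Y :: "'v::real_vector set"
  assumes "finite X" "finite Y"
  shows "dim (X \<union> Y) \<le> dim X + dim Y"
proof -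
  obtain C where C: "finite C" "X \<subseteq> span C" "card C = dim X"
    by (rule finite_basis_exists[OF assms(1) real_vector.span_superset])
  obtain D where D: "finite D" "Y \<subseteq> span D" "card D = dim Y"
    by (rule finite_basis_exists[OF assms(2) real_vector.span_superset])
  have "X \<union> Y \<subseteq> span (C \<union> D)"
    using C(2) D(2) real_vector.span_mono[of C "C \<union> D"] real_vector.span_mono[of D "C \<union> D"] by blast
  then have "dim (X \<union> Y) \<le> card (C \<union> D)"
    using C D by (intro real_vector.dim_le_card) auto
  with card_Un_le[of C D] C D show ?thesis by linarith
qed

definition matrix_row :: "('r \<Rightarrow> 'c \<Rightarrow> real) \<Rightarrow> 'c set \<Rightarrow> 'r \<Rightarrow> ('c \<Rightarrow>\<^sub>0 real)" where
  "matrix_row M S r = (\<Sum>s\<in>S. Poly_Mapping.single s (M r s))"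

text \<open>
  Row and column index sets are arguments because all ranks below are ranks of submatrices of one
  incidence matrix.
\<close>

definition submatrix_rank :: "('r \<Rightarrow> 'c \<Rightarrow> real) \<Rightarrow> 'r set \<Rightarrow> 'c set \<Rightarrow> nat" where
  "submatrix_rank M R S = dim (matrix_row M S ` R)"

definition restrict_columns :: "'c set \<Rightarrow> ('c \<Rightarrow>\<^sub>0 real) \<Rightarrow> ('c \<Rightarrow>\<^sub>0 real)" where
  "restrict_columns S x = (\<Sum>s\<in>S. Poly_Mapping.single s (Poly_Mapping.lookup x s))"

lemma lookup_matrix_row:
  "finite S \<Longrightarrow> Poly_Mapping.lookup (matrix_row M S r) s = (if s \<in> S then M r s else 0)"
  by (simp add: matrix_row_def lookup_sum lookup_single when_def)

lemma lookup_restrict_columns: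
  "finite S \<Longrightarrow> Poly_Mapping.lookup (restrict_columns S x) s =
    (if s \<in> S then Poly_Mapping.lookup x s else 0)"
  by (simp add: restrict_columns_def lookup_sum lookup_single when_def)

lemma linear_restrict_columns: "finite S \<Longrightarrow> linear (restrict_columns S)"
  by (intro linearI poly_mapping_eqI) (auto simp: lookup_restrict_columns lookup_add)

lemma restrict_matrix_row:
  "finite S' \<Longrightarrow> S \<subseteq> S' \<Longrightarrow> restrict_columns S (matrix_row M S' r) = matrix_row M S r"
  by (intro poly_mapping_eqI)
    (auto simp: lookup_restrict_columns lookup_matrix_row finite_subset)

lemma matrix_row_drop_zero_columns:
  assumes "finite S'" "S \<subseteq> S'" "\<And>s. s \<in> S' - S \<Longrightarrow> M r s = 0"
  shows "matrix_row M S' r = matrix_row M S r"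
  using assms by (intro poly_mapping_eqI) (auto simp: lookup_matrix_row finite_subset)

lemma submatrix_rank_cong:
  assumes "R = R'" "S = S'" "\<And>r s. r \<in> R' \<Longrightarrow> s \<in> S' \<Longrightarrow> M r s = M' r s"
  shows "submatrix_rank M R S = submatrix_rank M' R' S'"
proof -
  have "matrix_row M S ` R = matrix_row M' S' ` R'"
    using assms by (auto simp: matrix_row_def intro!: image_cong sum.cong)
  then show ?thesis by (simp add: submatrix_rank_def)
qed

lemma submatrix_rank_empty [simp]:
  "submatrix_rank M {} S = 0"
  by (simp add: submatrix_rank_def real_vector.dim_eq_card_independent[OF real_vector.independent_empty])

lemma submatrix_rank_drop_zero_columns:
  assumes "finite S'" "S \<subseteq> S'" "\<And>r s. r \<in> R \<Longrightarrow> s \<in> S' - S \<Longrightarrow> M r s = 0"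
  shows "submatrix_rank M R S' = submatrix_rank M R S"
proof -
  have "matrix_row M S' ` R = matrix_row M S ` R"
    using assms by (intro image_cong refl matrix_row_drop_zero_columns) auto
  then show ?thesis by (simp add: submatrix_rank_def)
qed

lemma submatrix_rank_mono:
  assumes fin: "finite R'" "finite S'" and sub: "R \<subseteq> R'" "S \<subseteq> S'"
  shows "submatrix_rank M R S \<le> submatrix_rank M R' S'"
proof -
  have "submatrix_rank M R S = dim (restrict_columns S ` matrix_row M S' ` R)"
    by (simp add: submatrix_rank_def image_image restrict_matrix_row[OF fin(2) sub(2)])
  also have "\<dots> \<le> dim (matrix_row M S' ` R)"
    using fin sub by (intro dim_linear_image_le linear_restrict_columns) (auto intro: finite_subset)
  also have "\<dots> \<le> submatrix_rank M R' S'"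
    unfolding submatrix_rank_def using fin sub
    by (intro dim_mono_of_finite_span[OF finite_imageI[of R'] real_vector.span_superset]) auto
  finally show ?thesis .
qed

lemma submatrix_rank_single:
  assumes "M r s \<noteq> 0"
  shows "submatrix_rank M {r} {s} = 1"
proof -
  have "Poly_Mapping.single s (M r s) \<noteq> 0"
    using assms by (metis lookup_single_eq lookup_zero)
  then have "independent {Poly_Mapping.single s (M r s)}"
    by simp
  from real_vector.dim_eq_card_independent[OF this] show ?thesis
    by (simp add: submatrix_rank_def matrix_row_def)
qed

text \<open>
  Apply rank-nullity on the row space to the projection to the columns \<open>S'\<close>. Its image contains
  the rows \<open>R'\<close> restricted to \<open>S'\<close>, and its kernel contains the rows \<open>R\<close>, which vanish on \<open>S'\<close>.
\<close>

lemma submatrix_rank_triangular: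
  assumes fin: "finite R" "finite R'" "finite S" "finite S'"
    and zero: "\<And>r s. r \<in> R \<Longrightarrow> s \<in> S' \<Longrightarrow> M r s = 0"
  shows "submatrix_rank M R S + submatrix_rank M R' S' \<le> submatrix_rank M (R \<union> R') (S \<union> S')"
proof -
  let ?rows = "matrix_row M (S \<union> S') ` (R \<union> R')"
  let ?V = "span ?rows" and ?T = "restrict_columns S'"
  have T: "linear ?T" using fin by (simp add: linear_restrict_columns)
  have "submatrix_rank M R' S' \<le> dim (?T ` ?V)"
  proof -
    have "submatrix_rank M R' S' \<le> submatrix_rank M (R \<union> R') S'"
      using fin by (intro submatrix_rank_mono) auto
    also have "\<dots> = dim (span (?T ` ?rows))"
      using fin by (simp add: submatrix_rank_def image_image restrict_matrix_row)
    also have "span (?T ` ?rows) = ?T ` ?V"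
      using linear_span_image[OF T] by simp
    finally show ?thesis .
  qed
  moreover have "submatrix_rank M R S \<le> dim {x \<in> ?V. ?T x = 0}"
  proof -
    have "submatrix_rank M R S \<le> dim (matrix_row M (S \<union> S') ` R)"
      using submatrix_rank_mono[of R "S \<union> S'" R S M] fin by (simp add: submatrix_rank_def)
    also have "\<dots> \<le> dim {x \<in> ?V. ?T x = 0}"
    proof (rule dim_mono_of_finite_span[of ?rows])
      have "restrict_columns S' (matrix_row M (S \<union> S') r) = 0" if "r \<in> R" for r
        using fin zero that by (intro poly_mapping_eqI)
          (auto simp: lookup_restrict_columns lookup_matrix_row)
      then show "matrix_row M (S \<union> S') ` R \<subseteq> {x \<in> ?V. ?T x = 0}"
        by (auto intro: real_vector.span_base)
    qed (use fin in auto)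
    finally show ?thesis .
  qed
  moreover have "submatrix_rank M (R \<union> R') (S \<union> S') = dim (?T ` ?V) + dim {x \<in> ?V. ?T x = 0}"
    using rank_nullity[OF T, of ?V ?rows] fin by (simp add: submatrix_rank_def)
  ultimately show ?thesis by linarith
qed

text \<open>
  In general only an inequality holds: the entries below the diagonal blocks may increase the rank.
\<close>

lemma submatrix_rank_block_triangular:
  fixes R :: "'i::linorder \<Rightarrow> 'r set" and S :: "'i \<Rightarrow> 'c set"
  assumes "finite I" and fin: "\<And>i. i \<in> I \<Longrightarrow> finite (R i)" "\<And>i. i \<in> I \<Longrightarrow> finite (S i)"
    and zero: "\<And>i j r s. \<lbrakk>i \<in> I; j \<in> I; i < j; r \<in> R i; s \<in> S j\<rbrakk> \<Longrightarrow> M r s = 0"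
  shows "(\<Sum>i\<in>I. submatrix_rank M (R i) (S i)) \<le> submatrix_rank M (\<Union>i\<in>I. R i) (\<Union>i\<in>I. S i)"
  using assms
proof (induction I rule: finite_linorder_max_induct)
  case (insert b I)
  have "b \<notin> I" using insert.hyps by auto
  have IH: "(\<Sum>i\<in>I. submatrix_rank M (R i) (S i)) \<le> submatrix_rank M (\<Union>i\<in>I. R i) (\<Union>i\<in>I. S i)"
    by (rule insert.IH) (use insert.prems in \<open>blast+\<close>)
  have "submatrix_rank M (\<Union>i\<in>I. R i) (\<Union>i\<in>I. S i) + submatrix_rank M (R b) (S b)
      \<le> submatrix_rank M ((\<Union>i\<in>I. R i) \<union> R b) ((\<Union>i\<in>I. S i) \<union> S b)"
  proof (rule submatrix_rank_triangular)
    fix r s assume "r \<in> (\<Union>i\<in>I. R i)" "s \<in> S b"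
    then obtain i where "i \<in> I" "r \<in> R i" by blast
    with \<open>s \<in> S b\<close> show "M r s = 0"
      using insert.hyps by (intro insert.prems(3)[of i b]) auto
  qed (use insert.hyps insert.prems in auto)
  with IH \<open>b \<notin> I\<close> insert.hyps show ?case by (simp add: Un_commute)
qed auto

text \<open>
  Here the row space is moreover the sum of the row spaces of the blocks, which bounds the rank
  from above.
\<close>

lemma submatrix_rank_block_diagonal:
  assumes "finite I" and fin: "\<And>i. i \<in> I \<Longrightarrow> finite (R i)" "\<And>i. i \<in> I \<Longrightarrow> finite (S i)"
    and zero: "\<And>i j r s. \<lbrakk>i \<in> I; j \<in> I; i \<noteq> j; r \<in> R i; s \<in> S j\<rbrakk> \<Longrightarrow> M r s = 0"
  shows "submatrix_rank M (\<Union>i\<in>I. R i) (\<Union>i\<in>I. S i) = (\<Sum>i\<in>I. submatrix_rank M (R i) (S i))"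
  using assms
proof (induction I rule: finite_induct)
  case (insert b I)
  define R' S' where "R' = (\<Union>i\<in>I. R i)" and "S' = (\<Union>i\<in>I. S i)"
  have finR: "finite (R b)" "finite R'" and finS: "finite (S b)" "finite S'"
    using insert by (auto simp: R'_def S'_def)
  have z1: "M r s = 0" if "r \<in> R b" "s \<in> S'" for r s
    using insert.prems(3)[of b _ r s] insert.hyps that by (auto simp: S'_def)
  have z2: "M r s = 0" if "r \<in> R'" "s \<in> S b" for r s
    using insert.prems(3)[of _ b r s] insert.hyps that by (auto simp: R'_def)
  have "submatrix_rank M (R b) (S b) + submatrix_rank M R' S' \<le> submatrix_rank M (R b \<union> R') (S b \<union> S')"
    using finR finS z1 by (intro submatrix_rank_triangular) auto
  moreover have "submatrix_rank M (R b \<union> R') (S b \<union> S')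
      \<le> submatrix_rank M (R b) (S b \<union> S') + submatrix_rank M R' (S b \<union> S')"
    unfolding submatrix_rank_def image_Un by (rule dim_Un_le) (use finR in auto)
  moreover have "submatrix_rank M (R b) (S b \<union> S') = submatrix_rank M (R b) (S b)"
    using finS z1 by (intro submatrix_rank_drop_zero_columns) auto
  moreover have "submatrix_rank M R' (S b \<union> S') = submatrix_rank M R' S'"
    using finS z2 by (intro submatrix_rank_drop_zero_columns) auto
  ultimately have "submatrix_rank M (R b \<union> R') (S b \<union> S') =
      submatrix_rank M (R b) (S b) + submatrix_rank M R' S'" by linarith
  moreover have "submatrix_rank M R' S' = (\<Sum>i\<in>I. submatrix_rank M (R i) (S i))"
    unfolding R'_def S'_def by (rule insert.IH) (use insert.prems in \<open>blast+\<close>)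
  ultimately show ?case using insert.hyps by (simp add: R'_def S'_def)
qed auto

lemma submatrix_rank_diagonal:
  assumes "finite A" and "\<And>a. a \<in> A \<Longrightarrow> M a (m a) \<noteq> 0"
    and "\<And>a b. \<lbrakk>a \<in> A; b \<in> A; a \<noteq> b\<rbrakk> \<Longrightarrow> M a (m b) = 0"
  shows "submatrix_rank M A (m ` A) = card A"
proof -
  have "submatrix_rank M (\<Union>a\<in>A. {a}) (\<Union>a\<in>A. {m a}) = (\<Sum>a\<in>A. submatrix_rank M {a} {m a})"
    using assms by (intro submatrix_rank_block_diagonal) auto
  also have "\<dots> = (\<Sum>a\<in>A. 1)"
    using assms(2) by (intro sum.cong refl submatrix_rank_single)
  finally show ?thesis by (simp add: UNION_singleton_eq_range)
qed

lemma submatrix_rank_no_columns [simp]: "submatrix_rank M R {} = 0"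
proof -
  have "dim (matrix_row M {} ` R) \<le> card ({} :: ('b \<Rightarrow>\<^sub>0 real) set)"
    by (rule real_vector.dim_le_card) (auto simp: matrix_row_def)
  then show ?thesis by (simp add: submatrix_rank_def)
qed


section \<open>Betti numbers from ranks of boundary maps\<close>

text \<open>
  The \<open>(k-1)\<close>-cells, with the empty set for \<open>k = 0\<close>; natural-number subtraction would give the
  \<open>0\<close>-cells there.
\<close>

definition face_cells :: "'a lefschetz \<Rightarrow> nat \<Rightarrow> 'a set" where
  "face_cells K k = {\<sigma> \<in> cells K. cell_dim K \<sigma> + 1 = k}"

definition boundary_rank :: "'a lefschetz \<Rightarrow> nat \<Rightarrow> nat" where
  "boundary_rank K k = submatrix_rank (incidence K) (k_cells K k) (face_cells K k)"

lemma face_cells_0 [simp]: "face_cells K 0 = {}"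
  by (simp add: face_cells_def)

lemma face_cells_Suc [simp]: "face_cells K (Suc k) = k_cells K k"
  by (simp add: face_cells_def k_cells_def)

lemma boundary_rank_0 [simp]: "boundary_rank K 0 = 0"
  by (simp add: boundary_rank_def)

lemma boundary_eq_matrix_rows:
  "boundary K k c =
    (\<Sum>\<tau>\<in>k_cells K k. Poly_Mapping.lookup c \<tau> *\<^sub>R matrix_row (incidence K) (face_cells K k) \<tau>)"
  by (simp add: boundary_def matrix_row_def face_cells_def)

lemma linear_boundary: "linear (boundary K k)"
  by (intro linearI)
    (simp_all add: boundary_eq_matrix_rows lookup_add scaleR_add_left sum.distrib scaleR_sum_right)

lemma mem_chains_iff: "c \<in> chains K k \<longleftrightarrow> (\<forall>x. x \<notin> k_cells K k \<longrightarrow> Poly_Mapping.lookup c x = 0)"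
  by (auto simp: chains_def in_keys_iff)

lemma subspace_chains: "real_vector.subspace (chains K k)"
  by (intro real_vector.subspaceI) (auto simp: mem_chains_iff lookup_add)

lemma subspace_cycles: "real_vector.subspace (cycles K k)"
proof -
  interpret linear "boundary K k" by (rule linear_boundary)
  show ?thesis
    using subspace_chains[of K k]
    by (intro real_vector.subspaceI)
      (auto simp: cycles_def zero add scale intro: real_vector.subspace_0
        real_vector.subspace_add real_vector.subspace_scale)
qed

lemma subspace_boundaries: "real_vector.subspace (boundaries K k)"
  unfolding boundaries_def by (rule linear_subspace_image[OF linear_boundary subspace_chains])

context lefschetz_complex
begin

lemma finite_face_cells: "finite (face_cells K k)"
  using finite_k_cells by (cases k) auto

lemma chains_eq_span: "chains K k = span ((\<lambda>\<tau>. Poly_Mapping.single \<tau> 1) ` k_cells K k)"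
proof
  show "chains K k \<subseteq> span ((\<lambda>\<tau>. Poly_Mapping.single \<tau> 1) ` k_cells K k)"
  proof
    fix c assume c: "c \<in> chains K k"
    have "c = (\<Sum>\<tau>\<in>k_cells K k. Poly_Mapping.lookup c \<tau> *\<^sub>R Poly_Mapping.single \<tau> 1)"
      using c finite_k_cells
      by (intro poly_mapping_eqI) (auto simp: lookup_sum lookup_single when_def mem_chains_iff if_distrib sum.delta cong: if_cong)
    also have "\<dots> \<in> span ((\<lambda>\<tau>. Poly_Mapping.single \<tau> 1) ` k_cells K k)"
      by (intro real_vector.span_sum real_vector.span_scale real_vector.span_base) auto
    finally show "c \<in> span ((\<lambda>\<tau>. Poly_Mapping.single \<tau> 1) ` k_cells K k)" .
  qed
  show "span ((\<lambda>\<tau>. Poly_Mapping.single \<tau> 1) ` k_cells K k) \<subseteq> chains K k"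
    by (intro real_vector.span_minimal subspace_chains)
      (auto simp: mem_chains_iff lookup_single when_def)
qed

lemma dim_chains: "dim (chains K k) = card (k_cells K k)"
proof -
  \<comment> \<open>The basis of \<open>k\<close>-cells consists of the rows of an identity matrix.\<close>
  define \<delta> :: "'a \<Rightarrow> 'a \<Rightarrow> real" where "\<delta> \<tau> \<sigma> = (if \<tau> = \<sigma> then 1 else 0)" for \<tau> \<sigma>
  have "matrix_row \<delta> (k_cells K k) \<tau> = Poly_Mapping.single \<tau> 1" if "\<tau> \<in> k_cells K k" for \<tau>
    using that finite_k_cells
    by (intro poly_mapping_eqI) (auto simp: lookup_matrix_row lookup_single \<delta>_def when_def)
  then have "dim (chains K k) = submatrix_rank \<delta> (k_cells K k) ((\<lambda>\<tau>. \<tau>) ` k_cells K k)"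
    by (simp add: chains_eq_span submatrix_rank_def cong: image_cong)
  also have "\<dots> = card (k_cells K k)"
    using finite_k_cells by (intro submatrix_rank_diagonal) (auto simp: \<delta>_def)
  finally show ?thesis .
qed

lemma dim_boundary_image: "dim (boundary K k ` chains K k) = boundary_rank K k"
proof -
  have "boundary K k (Poly_Mapping.single \<tau> 1) = matrix_row (incidence K) (face_cells K k) \<tau>"
    if "\<tau> \<in> k_cells K k" for \<tau>
  proof -
    have "boundary K k (Poly_Mapping.single \<tau> 1) =
        (\<Sum>\<tau>'\<in>k_cells K k. if \<tau>' = \<tau> then matrix_row (incidence K) (face_cells K k) \<tau>' else 0)"
      unfolding boundary_eq_matrix_rows
      by (intro sum.cong) (auto simp: lookup_single when_def)
    then show ?thesis using that finite_k_cells by simp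
  qed
  then have "boundary K k ` chains K k = span (matrix_row (incidence K) (face_cells K k) ` k_cells K k)"
    by (simp add: chains_eq_span image_image flip: linear_span_image[OF linear_boundary] cong: image_cong)
  then show ?thesis by (simp add: boundary_rank_def submatrix_rank_def)
qed

lemma dim_boundaries: "dim (boundaries K k) = boundary_rank K (k + 1)"
  unfolding boundaries_def by (rule dim_boundary_image)

lemma incidence_square_k_cells:
  assumes "\<tau> \<in> k_cells K (Suc k)" "\<nu> \<in> cells K"
  shows "(\<Sum>\<sigma>\<in>k_cells K k. incidence K \<tau> \<sigma> * incidence K \<sigma> \<nu>) = 0"
proof -
  have "(\<Sum>\<sigma>\<in>k_cells K k. incidence K \<tau> \<sigma> * incidence K \<sigma> \<nu>) =
      (\<Sum>\<sigma> | \<sigma> \<in> cells K \<and> incidence K \<tau> \<sigma> \<noteq> 0. incidence K \<tau> \<sigma> * incidence K \<sigma> \<nu>)"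
    using assms incidence_dim[of \<tau>] finite_k_cells
    by (intro sum.mono_neutral_right) (force simp: k_cells_def)+
  also have "\<dots> = 0" using assms by (intro incidence_square) (auto simp: k_cells_def)
  finally show ?thesis .
qed

lemma boundary_boundary: "boundary K k (boundary K (Suc k) c) = 0"
proof (rule poly_mapping_eqI)
  fix \<nu>
  have row: "Poly_Mapping.lookup (matrix_row (incidence K) (face_cells K j) \<tau>) \<sigma> =
      (if \<sigma> \<in> face_cells K j then incidence K \<tau> \<sigma> else 0)" for \<tau> \<sigma> j
    using finite_face_cells by (rule lookup_matrix_row)
  have "(\<Sum>\<sigma>\<in>k_cells K k. (\<Sum>\<tau>\<in>k_cells K (Suc k). Poly_Mapping.lookup c \<tau> * incidence K \<tau> \<sigma>) * incidence K \<sigma> \<nu>) = 0"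
    if "\<nu> \<in> cells K"
  proof -
    have "(\<Sum>\<sigma>\<in>k_cells K k. (\<Sum>\<tau>\<in>k_cells K (Suc k). Poly_Mapping.lookup c \<tau> * incidence K \<tau> \<sigma>) * incidence K \<sigma> \<nu>)
      = (\<Sum>\<tau>\<in>k_cells K (Suc k). \<Sum>\<sigma>\<in>k_cells K k. Poly_Mapping.lookup c \<tau> * incidence K \<tau> \<sigma> * incidence K \<sigma> \<nu>)"
      by (simp add: sum_distrib_right sum.swap[of _ "k_cells K k"])
    also have "\<dots> = (\<Sum>\<tau>\<in>k_cells K (Suc k). Poly_Mapping.lookup c \<tau> *
        (\<Sum>\<sigma>\<in>k_cells K k. incidence K \<tau> \<sigma> * incidence K \<sigma> \<nu>))"
      by (simp add: sum_distrib_left mult.assoc)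
    also have "\<dots> = 0" using that by (simp add: incidence_square_k_cells)
    finally show ?thesis .
  qed
  moreover have "\<nu> \<in> cells K" if "\<nu> \<in> face_cells K k"
    using that by (simp add: face_cells_def)
  ultimately show "Poly_Mapping.lookup (boundary K k (boundary K (Suc k) c)) \<nu> = Poly_Mapping.lookup 0 \<nu>"
    using row[of k] row[of "Suc k"]
    by (cases "\<nu> \<in> face_cells K k") (auto simp: boundary_eq_matrix_rows lookup_sum)
qed

lemma boundaries_subset_cycles: "boundaries K k \<subseteq> cycles K k"
proof -
  have "boundary K (Suc k) c \<in> chains K k" for c
    using finite_face_cells[of "Suc k"]
    by (auto simp: mem_chains_iff boundary_eq_matrix_rows lookup_sum lookup_matrix_row)
  then show ?thesis by (auto simp: boundaries_def cycles_def boundary_boundary)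
qed

lemma betti_plus_ranks:
  "betti K k + boundary_rank K k + boundary_rank K (k + 1) = card (k_cells K k)"
proof -
  let ?B = "(\<lambda>\<tau>. Poly_Mapping.single \<tau> (1::real)) ` k_cells K k"
  have B: "finite ?B" "chains K k \<subseteq> span ?B"
    using finite_k_cells by (simp_all add: chains_eq_span)
  have "cycles K k \<subseteq> span ?B" using B(2) by (auto simp: cycles_def)
  from dim_quotient_space[OF subspace_boundaries subspace_cycles boundaries_subset_cycles B(1) this]
  have "betti K k + boundary_rank K (k + 1) = dim (cycles K k)"
    by (simp add: betti_def homology_def dim_boundaries)
  moreover have "dim (chains K k) = boundary_rank K k + dim (cycles K k)"
    using rank_nullity[OF linear_boundary[of K k] subspace_chains B]
    by (simp add: dim_boundary_image cycles_def)
  ultimately show ?thesis by (simp add: dim_chains)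
qed

end


section \<open>Paths through a middle cell\<close>

locale morse_bott = lefschetz_complex K for K :: "'a lefschetz" +
  fixes f :: "'a \<Rightarrow> real"
  assumes discrete_morse_bott: "discrete_morse_bott K f"
begin

lemma finite_cofaces: "\<sigma> \<in> cells K \<Longrightarrow> finite {\<tau> \<in> cells K. incidence K \<tau> \<sigma> \<noteq> 0 \<and> f \<sigma> > f \<tau>}"
  by (rule finite_subset[OF _ finite_k_cells[of "cell_dim K \<sigma> + 1"]])
    (use incidence_dim[of _ \<sigma>] in \<open>force simp: k_cells_def\<close>)

lemma finite_faces: "\<sigma> \<in> cells K \<Longrightarrow> finite {\<nu> \<in> cells K. incidence K \<sigma> \<nu> \<noteq> 0 \<and> f \<sigma> < f \<nu>}"
  by (rule finite_subset[OF _ finite_face_cells[of "cell_dim K \<sigma>"]])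
    (use incidence_dim[of \<sigma>] in \<open>force simp: face_cells_def\<close>)

lemma U_snc_eq_0_iff:
  "\<sigma> \<in> cells K \<Longrightarrow> U_snc K f \<sigma> = 0 \<longleftrightarrow> (\<forall>\<tau>\<in>cells K. incidence K \<tau> \<sigma> \<noteq> 0 \<longrightarrow> f \<sigma> \<le> f \<tau>)"
  using finite_cofaces[of \<sigma>] by (auto simp: U_snc_def not_less)

lemma D_snc_eq_0_iff:
  "\<sigma> \<in> cells K \<Longrightarrow> D_snc K f \<sigma> = 0 \<longleftrightarrow> (\<forall>\<nu>\<in>cells K. incidence K \<sigma> \<nu> \<noteq> 0 \<longrightarrow> f \<nu> \<le> f \<sigma>)"
  using finite_faces[of \<sigma>] by (auto simp: D_snc_def not_less)

lemma U_snc_cases: "\<sigma> \<in> cells K \<Longrightarrow> U_snc K f \<sigma> = 0 \<or> U_snc K f \<sigma> = 1"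
  using discrete_morse_bott by (fastforce simp: discrete_morse_bott_def)

lemma D_snc_cases: "\<sigma> \<in> cells K \<Longrightarrow> D_snc K f \<sigma> = 0 \<or> D_snc K f \<sigma> = 1"
  using discrete_morse_bott by (fastforce simp: discrete_morse_bott_def)

text \<open>
  A coface of \<open>\<sigma>\<close> is exceptional if \<open>f\<close> is smaller there than at \<open>\<sigma>\<close>, a face if \<open>f\<close> is larger there;
  \<open>U_snc\<close> and \<open>D_snc\<close> count these cells.
\<close>

lemma exceptional_coface_unique:
  assumes "\<sigma> \<in> cells K" "\<tau> \<in> cells K" "\<tau>' \<in> cells K"
    "incidence K \<tau> \<sigma> \<noteq> 0" "incidence K \<tau>' \<sigma> \<noteq> 0" "f \<tau> < f \<sigma>" "f \<tau>' < f \<sigma>"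
  shows "\<tau> = \<tau>'"
proof -
  have "card {\<tau> \<in> cells K. incidence K \<tau> \<sigma> \<noteq> 0 \<and> f \<sigma> > f \<tau>} \<le> Suc 0"
    using discrete_morse_bott assms(1) by (simp add: discrete_morse_bott_def U_snc_def)
  then show ?thesis
    using assms card_le_Suc0_iff_eq[OF finite_cofaces[OF assms(1)]] by blast
qed

lemma exceptional_face_unique:
  assumes "\<sigma> \<in> cells K" "\<nu> \<in> cells K" "\<nu>' \<in> cells K"
    "incidence K \<sigma> \<nu> \<noteq> 0" "incidence K \<sigma> \<nu>' \<noteq> 0" "f \<sigma> < f \<nu>" "f \<sigma> < f \<nu>'"
  shows "\<nu> = \<nu>'"
proof -
  have "card {\<nu> \<in> cells K. incidence K \<sigma> \<nu> \<noteq> 0 \<and> f \<sigma> < f \<nu>} \<le> Suc 0"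
    using discrete_morse_bott assms(1) by (simp add: discrete_morse_bott_def D_snc_def)
  then show ?thesis
    using assms card_le_Suc0_iff_eq[OF finite_faces[OF assms(1)]] by blast
qed

lemma finite_incidence_support:
  assumes "\<tau> \<in> cells K" shows "finite {\<sigma> \<in> cells K. incidence K \<tau> \<sigma> \<noteq> 0}"
  by (rule finite_subset[OF _ finite_face_cells[of "cell_dim K \<tau>"]])
    (use assms incidence_dim[of \<tau>] in \<open>force simp: face_cells_def\<close>)

text \<open>
  A sum that vanishes and has a nonzero term has a second nonzero term.
\<close>

lemma other_middle_cell:
  assumes "\<tau> \<in> cells K" "\<sigma> \<in> cells K" "\<nu> \<in> cells K" "incidence K \<tau> \<sigma> \<noteq> 0" "incidence K \<sigma> \<nu> \<noteq> 0"
  obtains \<sigma>' where "\<sigma>' \<in> cells K" "\<sigma>' \<noteq> \<sigma>" "incidence K \<tau> \<sigma>' \<noteq> 0" "incidence K \<sigma>' \<nu> \<noteq> 0"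
proof -
  let ?S = "{\<sigma> \<in> cells K. incidence K \<tau> \<sigma> \<noteq> 0}"
  have fin: "finite ?S" by (rule finite_incidence_support[OF assms(1)])
  have "\<sigma> \<in> ?S" using assms by simp
  from sum.remove[OF fin this, of "\<lambda>\<sigma>'. incidence K \<tau> \<sigma>' * incidence K \<sigma>' \<nu>"]
  have "(\<Sum>\<sigma>'\<in>?S - {\<sigma>}. incidence K \<tau> \<sigma>' * incidence K \<sigma>' \<nu>) \<noteq> 0"
    using incidence_square[OF assms(1,3)] assms(4,5) by (metis add.right_neutral mult_eq_0_iff)
  then obtain \<sigma>' where "\<sigma>' \<in> ?S - {\<sigma>}" "incidence K \<tau> \<sigma>' * incidence K \<sigma>' \<nu> \<noteq> 0"
    by (rule sum.not_neutral_contains_not_neutral)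
  then show ?thesis by (intro that[of \<sigma>']) auto
qed

text \<open>
  Suppose \<open>\<tau>\<close> is a coface with \<open>f \<tau> < f \<sigma>\<close> and \<open>\<nu>\<close> a face with \<open>f \<nu> > f \<sigma>\<close>. Since \<open>\<sigma>\<close> is the only
  exceptional coface of \<open>\<nu>\<close> and the only exceptional face of \<open>\<tau>\<close>, a second middle cell \<open>\<sigma>'\<close>
  satisfies \<open>f \<nu> \<le> f \<sigma>' \<le> f \<tau>\<close>, which contradicts \<open>f \<tau> < f \<nu>\<close>.
\<close>

lemma U_snc_or_D_snc_eq_0:
  assumes \<sigma>: "\<sigma> \<in> cells K"
  shows "U_snc K f \<sigma> = 0 \<or> D_snc K f \<sigma> = 0"
proof (rule ccontr)
  assume "\<not> ?thesis"
  then obtain \<tau> \<nu> where \<tau>: "\<tau> \<in> cells K" "incidence K \<tau> \<sigma> \<noteq> 0" "f \<tau> < f \<sigma>"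
    and \<nu>: "\<nu> \<in> cells K" "incidence K \<sigma> \<nu> \<noteq> 0" "f \<sigma> < f \<nu>"
    using U_snc_eq_0_iff[OF \<sigma>] D_snc_eq_0_iff[OF \<sigma>] by force
  obtain \<sigma>' where \<sigma>': "\<sigma>' \<in> cells K" "\<sigma>' \<noteq> \<sigma>" "incidence K \<tau> \<sigma>' \<noteq> 0" "incidence K \<sigma>' \<nu> \<noteq> 0"
    by (rule other_middle_cell[OF \<tau>(1) \<sigma> \<nu>(1) \<tau>(2) \<nu>(2)])
  have "f \<nu> \<le> f \<sigma>'"
    using exceptional_coface_unique[of \<nu> \<sigma> \<sigma>'] \<sigma> \<sigma>' \<nu> by force
  moreover have "f \<sigma>' \<le> f \<tau>"
    using exceptional_face_unique[of \<tau> \<sigma> \<sigma>'] \<sigma> \<sigma>' \<tau> by force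
  ultimately show False using \<tau>(3) \<nu>(3) by linarith
qed


section \<open>The weakly critical complex\<close>

definition weakly_critical :: "'a set" where
  "weakly_critical = {\<sigma> \<in> cells K. U_snc K f \<sigma> = 0 \<and> D_snc K f \<sigma> = 0}"

text \<open>
  The level is squeezed between \<open>f \<nu>\<close> and \<open>f \<tau>\<close>. If \<open>\<sigma>\<close> had an exceptional face \<open>\<nu>'\<close>, a second
  path from \<open>\<tau>\<close> to \<open>\<nu>'\<close> would pass through another cell \<open>\<sigma>'\<close> with \<open>f \<sigma>' \<le> f \<tau> = f \<sigma> < f \<nu>'\<close>, a second
  exceptional coface of \<open>\<nu>'\<close>. An exceptional coface of \<open>\<sigma>\<close> is excluded dually.
\<close>

lemma weakly_critical_middle_cell:
  assumes \<tau>: "\<tau> \<in> weakly_critical" and \<nu>: "\<nu> \<in> weakly_critical" and eq: "f \<tau> = f \<nu>"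
    and \<sigma>: "\<sigma> \<in> cells K" "incidence K \<tau> \<sigma> \<noteq> 0" "incidence K \<sigma> \<nu> \<noteq> 0"
  shows "f \<sigma> = f \<tau>" and "\<sigma> \<in> weakly_critical"
proof -
  have cells: "\<tau> \<in> cells K" "\<nu> \<in> cells K"
    using \<tau> \<nu> by (auto simp: weakly_critical_def)
  have below: "f x \<le> f \<tau>" if "x \<in> cells K" "incidence K \<tau> x \<noteq> 0" for x
    using \<tau> D_snc_eq_0_iff[OF cells(1)] that by (auto simp: weakly_critical_def)
  have above: "f \<nu> \<le> f x" if "x \<in> cells K" "incidence K x \<nu> \<noteq> 0" for x
    using \<nu> U_snc_eq_0_iff[OF cells(2)] that by (auto simp: weakly_critical_def)
  show level: "f \<sigma> = f \<tau>"
    using below[OF \<sigma>(1,2)] above[OF \<sigma>(1,3)] eq by simp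
  have "f \<nu>' \<le> f \<sigma>" if \<nu>': "\<nu>' \<in> cells K" "incidence K \<sigma> \<nu>' \<noteq> 0" for \<nu>'
  proof (rule ccontr)
    assume "\<not> f \<nu>' \<le> f \<sigma>"
    obtain \<sigma>' where \<sigma>': "\<sigma>' \<in> cells K" "\<sigma>' \<noteq> \<sigma>" "incidence K \<tau> \<sigma>' \<noteq> 0" "incidence K \<sigma>' \<nu>' \<noteq> 0"
      by (rule other_middle_cell[OF cells(1) \<sigma>(1) \<nu>'(1) \<sigma>(2) \<nu>'(2)])
    then show False
      using exceptional_coface_unique[of \<nu>' \<sigma> \<sigma>'] \<sigma>(1) \<nu>' below[of \<sigma>'] level \<open>\<not> f \<nu>' \<le> f \<sigma>\<close> by force
  qed
  moreover have "f \<sigma> \<le> f \<tau>'" if \<tau>': "\<tau>' \<in> cells K" "incidence K \<tau>' \<sigma> \<noteq> 0" for \<tau>'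
  proof (rule ccontr)
    assume "\<not> f \<sigma> \<le> f \<tau>'"
    obtain \<sigma>' where \<sigma>': "\<sigma>' \<in> cells K" "\<sigma>' \<noteq> \<sigma>" "incidence K \<tau>' \<sigma>' \<noteq> 0" "incidence K \<sigma>' \<nu> \<noteq> 0"
      by (rule other_middle_cell[OF \<tau>'(1) \<sigma>(1) cells(2) \<tau>'(2) \<sigma>(3)])
    then show False
      using exceptional_face_unique[of \<tau>' \<sigma> \<sigma>'] \<sigma>(1) \<tau>' above[of \<sigma>'] level eq \<open>\<not> f \<sigma> \<le> f \<tau>'\<close> by force
  qed
  ultimately show "\<sigma> \<in> weakly_critical"
    using \<sigma>(1) U_snc_eq_0_iff D_snc_eq_0_iff by (simp add: weakly_critical_def)
qed

definition critical_level :: "real \<Rightarrow> 'a lefschetz" where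
  "critical_level r = restrict_cells K {\<sigma> \<in> weakly_critical. f \<sigma> = r}"

lemma critical_level_simps [simp]:
  "cells (critical_level r) = {\<sigma> \<in> weakly_critical. f \<sigma> = r}"
  "cell_dim (critical_level r) = cell_dim K"
  "incidence (critical_level r) = incidence K"
  by (simp_all add: critical_level_def restrict_cells_def)

abbreviation "W \<equiv> weakly_critical_complex K f"

lemma weakly_critical_complex_simps [simp]:
  "cells W = weakly_critical"
  "cell_dim W = cell_dim K"
  "incidence W \<tau> \<sigma> = (if f \<tau> = f \<sigma> then incidence K \<tau> \<sigma> else 0)"
  by (simp_all add: weakly_critical_complex_def weakly_critical_def)

lemma weakly_critical_subset: "weakly_critical \<subseteq> cells K"
  by (auto simp: weakly_critical_def)

text \<open>
  This is the second axiom both for a single weakly critical set and for the weakly critical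
  complex: passing from \<open>K\<close> to one level of weakly critical cells loses no path.
\<close>

lemma critical_square:
  assumes "\<tau> \<in> weakly_critical" "\<nu> \<in> weakly_critical" "f \<tau> = f \<nu>"
  shows "(\<Sum>\<sigma> | \<sigma> \<in> weakly_critical \<and> f \<sigma> = f \<tau> \<and> incidence K \<tau> \<sigma> \<noteq> 0.
    incidence K \<tau> \<sigma> * incidence K \<sigma> \<nu>) = 0"
proof -
  have cells: "\<tau> \<in> cells K" "\<nu> \<in> cells K" using assms weakly_critical_subset by auto
  have "(\<Sum>\<sigma> | \<sigma> \<in> weakly_critical \<and> f \<sigma> = f \<tau> \<and> incidence K \<tau> \<sigma> \<noteq> 0.
      incidence K \<tau> \<sigma> * incidence K \<sigma> \<nu>) =
    (\<Sum>\<sigma> | \<sigma> \<in> cells K \<and> incidence K \<tau> \<sigma> \<noteq> 0. incidence K \<tau> \<sigma> * incidence K \<sigma> \<nu>)"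
    using finite_incidence_support[OF cells(1)] weakly_critical_subset
      weakly_critical_middle_cell[OF assms]
    by (intro sum.mono_neutral_left) auto
  with incidence_square[OF cells] show ?thesis by simp
qed

lemma lefschetz_critical_level: "lefschetz_complex (critical_level r)"
proof
  show "finite (k_cells (critical_level r) k)" for k
    by (rule finite_subset[OF _ finite_k_cells[of k]])
      (use weakly_critical_subset in \<open>auto simp: k_cells_def\<close>)
  show "int (cell_dim (critical_level r) \<tau>) - int (cell_dim (critical_level r) \<sigma>) = 1"
    if "\<tau> \<in> cells (critical_level r)" "\<sigma> \<in> cells (critical_level r)"
      "incidence (critical_level r) \<tau> \<sigma> \<noteq> 0" for \<tau> \<sigma>
    using that incidence_dim[of \<tau> \<sigma>] weakly_critical_subset by auto
  show "(\<Sum>\<sigma> | \<sigma> \<in> cells (critical_level r) \<and> incidence (critical_level r) \<tau> \<sigma> \<noteq> 0.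
      incidence (critical_level r) \<tau> \<sigma> * incidence (critical_level r) \<sigma> \<nu>) = 0"
    if "\<tau> \<in> cells (critical_level r)" "\<nu> \<in> cells (critical_level r)" for \<tau> \<nu>
    using that critical_square[of \<tau> \<nu>] by (auto simp: conj_assoc)
qed

lemma lefschetz_weakly_critical_complex: "lefschetz_complex W"
proof
  show "finite (k_cells W k)" for k
    by (rule finite_subset[OF _ finite_k_cells[of k]])
      (use weakly_critical_subset in \<open>auto simp: k_cells_def\<close>)
  show "int (cell_dim W \<tau>) - int (cell_dim W \<sigma>) = 1"
    if "\<tau> \<in> cells W" "\<sigma> \<in> cells W" "incidence W \<tau> \<sigma> \<noteq> 0" for \<tau> \<sigma>
    using that incidence_dim[of \<tau> \<sigma>] weakly_critical_subset by (auto split: if_splits)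
  show "(\<Sum>\<sigma> | \<sigma> \<in> cells W \<and> incidence W \<tau> \<sigma> \<noteq> 0. incidence W \<tau> \<sigma> * incidence W \<sigma> \<nu>) = 0"
    if "\<tau> \<in> cells W" "\<nu> \<in> cells W" for \<tau> \<nu>
  proof (cases "f \<tau> = f \<nu>")
    case True
    have "(\<Sum>\<sigma> | \<sigma> \<in> cells W \<and> incidence W \<tau> \<sigma> \<noteq> 0. incidence W \<tau> \<sigma> * incidence W \<sigma> \<nu>) =
      (\<Sum>\<sigma> | \<sigma> \<in> weakly_critical \<and> f \<sigma> = f \<tau> \<and> incidence K \<tau> \<sigma> \<noteq> 0.
        incidence K \<tau> \<sigma> * incidence K \<sigma> \<nu>)"
      using True by (intro sum.cong) (auto split: if_splits)
    with critical_square[of \<tau> \<nu>] that True show ?thesis by simp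
  next
    case False
    then show ?thesis by (intro sum.neutral) auto
  qed
qed

end

context morse_bott
begin


section \<open>Pairs of cells\<close>

definition upper_cells :: "nat \<Rightarrow> 'a set" where
  "upper_cells k = {\<sigma> \<in> k_cells K k. D_snc K f \<sigma> = 1}"

definition lower_cells :: "nat \<Rightarrow> 'a set" where
  "lower_cells k = {\<sigma> \<in> k_cells K k. U_snc K f \<sigma> = 1}"

definition partner :: "'a \<Rightarrow> 'a" where
  "partner \<sigma> = (SOME \<nu>. \<nu> \<in> cells K \<and> incidence K \<sigma> \<nu> \<noteq> 0 \<and> f \<sigma> < f \<nu>)"

lemma partner:
  assumes "\<sigma> \<in> cells K" "D_snc K f \<sigma> = 1"
  shows "partner \<sigma> \<in> cells K" "incidence K \<sigma> (partner \<sigma>) \<noteq> 0" "f \<sigma> < f (partner \<sigma>)"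
proof -
  have "\<exists>\<nu>. \<nu> \<in> cells K \<and> incidence K \<sigma> \<nu> \<noteq> 0 \<and> f \<sigma> < f \<nu>"
    using D_snc_eq_0_iff[OF assms(1)] assms(2) by force
  from someI_ex[OF this]
  show "partner \<sigma> \<in> cells K" "incidence K \<sigma> (partner \<sigma>) \<noteq> 0" "f \<sigma> < f (partner \<sigma>)"
    by (simp_all add: partner_def)
qed

text \<open>
  This inequality makes the boundary matrix triangular: a row \<open>\<tau> \<noteq> \<sigma>\<close> can meet the column
  of the partner of \<open>\<sigma>\<close> only if it comes strictly after the row \<open>\<sigma>\<close>. Indeed \<open>\<sigma>\<close> is the only
  exceptional coface of its partner, so \<open>f \<sigma> < f (partner \<sigma>) \<le> f \<tau>\<close>.
\<close>

lemma incidence_partner: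
  assumes "\<sigma> \<in> cells K" "D_snc K f \<sigma> = 1" "\<tau> \<in> cells K" "incidence K \<tau> (partner \<sigma>) \<noteq> 0" "\<tau> \<noteq> \<sigma>"
  shows "f \<sigma> < f \<tau>"
  using partner[OF assms(1,2)] exceptional_coface_unique[of "partner \<sigma>" \<tau> \<sigma>] assms by force

lemma bij_betw_partner: "bij_betw partner (upper_cells (Suc k)) (lower_cells k)"
proof (rule bij_betwI')
  fix \<sigma> \<tau> assume \<sigma>\<tau>: "\<sigma> \<in> upper_cells (Suc k)" "\<tau> \<in> upper_cells (Suc k)"
  then show "partner \<sigma> = partner \<tau> \<longleftrightarrow> \<sigma> = \<tau>"
    using partner[of \<sigma>] partner[of \<tau>] exceptional_coface_unique[of "partner \<sigma>" \<sigma> \<tau>]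
    by (auto simp: upper_cells_def k_cells_def)
next
  fix \<sigma> assume "\<sigma> \<in> upper_cells (Suc k)"
  then have \<sigma>: "\<sigma> \<in> cells K" "D_snc K f \<sigma> = 1" "cell_dim K \<sigma> = Suc k"
    by (auto simp: upper_cells_def k_cells_def)
  note p = partner[OF \<sigma>(1,2)]
  have "U_snc K f (partner \<sigma>) \<noteq> 0"
    using U_snc_eq_0_iff[OF p(1)] \<sigma>(1) p by force
  then show "partner \<sigma> \<in> lower_cells k"
    using U_snc_cases[OF p(1)] p(1) incidence_dim[OF \<sigma>(1) p(1,2)] \<sigma>(3)
    by (auto simp: lower_cells_def k_cells_def)
next
  fix \<nu> assume "\<nu> \<in> lower_cells k"
  then have \<nu>: "\<nu> \<in> cells K" "U_snc K f \<nu> = 1" "cell_dim K \<nu> = k"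
    by (auto simp: lower_cells_def k_cells_def)
  obtain \<sigma> where \<sigma>: "\<sigma> \<in> cells K" "incidence K \<sigma> \<nu> \<noteq> 0" "f \<sigma> < f \<nu>"
    using U_snc_eq_0_iff[OF \<nu>(1)] \<nu>(2) by force
  have "D_snc K f \<sigma> \<noteq> 0"
    using D_snc_eq_0_iff[OF \<sigma>(1)] \<nu>(1) \<sigma> by force
  then have D: "D_snc K f \<sigma> = 1" using D_snc_cases[OF \<sigma>(1)] by simp
  have "\<sigma> \<in> upper_cells (Suc k)"
    using D \<sigma>(1) incidence_dim[OF \<sigma>(1) \<nu>(1) \<sigma>(2)] \<nu>(3) by (auto simp: upper_cells_def k_cells_def)
  moreover have "\<nu> = partner \<sigma>"
    using exceptional_face_unique[of \<sigma> \<nu> "partner \<sigma>"] partner[OF \<sigma>(1) D] \<sigma> \<nu> by blast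
  ultimately show "\<exists>\<sigma>\<in>upper_cells (Suc k). \<nu> = partner \<sigma>" by blast
qed

lemma card_upper_cells: "card (upper_cells k) = d_snc K f k"
  by (simp add: upper_cells_def d_snc_def)

lemma card_k_cells:
  "card (k_cells K k) = card (k_cells W k) + d_snc K f k + d_snc K f (Suc k)"
proof -
  have "k_cells K k = (k_cells W k \<union> upper_cells k) \<union> lower_cells k"
    using U_snc_cases D_snc_cases
    by (fastforce simp: k_cells_def upper_cells_def lower_cells_def weakly_critical_def)
  moreover have "k_cells W k \<inter> upper_cells k = {}" "(k_cells W k \<union> upper_cells k) \<inter> lower_cells k = {}"
    using U_snc_or_D_snc_eq_0
    by (force simp: k_cells_def upper_cells_def lower_cells_def weakly_critical_def)+
  moreover have "finite (k_cells W k)" "finite (upper_cells k)" "finite (lower_cells k)"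
    using finite_k_cells[of k] lefschetz_complex.finite_k_cells[OF lefschetz_weakly_critical_complex]
    by (auto simp: upper_cells_def lower_cells_def)
  ultimately have "card (k_cells K k) = card (k_cells W k) + card (upper_cells k) + card (lower_cells k)"
    by (metis card_Un_disjoint finite_UnI)
  then show ?thesis
    using bij_betw_same_card[OF bij_betw_partner[of k]] by (simp add: card_upper_cells)
qed


section \<open>Comparison of boundary ranks\<close>

text \<open>
  Infinitely many levels may occur, but only finitely many carry \<open>k\<close>-cells; \<open>I\<close> may be any
  larger finite set of levels, so that one \<open>I\<close> can serve for two consecutive degrees.
\<close>

lemma boundary_rank_weakly_critical_complex:
  assumes "finite I" "f ` k_cells W k \<subseteq> I"
  shows "boundary_rank W k = (\<Sum>r\<in>I. boundary_rank (critical_level r) k)"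
proof -
  let ?R = "\<lambda>r. k_cells (critical_level r) k" and ?S = "\<lambda>r. face_cells (critical_level r) k"
  have fin: "finite (?R r)" "finite (?S r)" for r
    using lefschetz_complex.finite_k_cells[OF lefschetz_critical_level]
      lefschetz_complex.finite_face_cells[OF lefschetz_critical_level] by auto
  have rows: "k_cells W k = (\<Union>r\<in>I. ?R r)"
    using assms(2) by (auto simp: k_cells_def)
  have "boundary_rank W k = submatrix_rank (incidence W) (k_cells W k) (\<Union>r\<in>I. ?S r)"
    unfolding boundary_rank_def
  proof (rule submatrix_rank_drop_zero_columns)
    show "finite (face_cells W k)"
      by (rule lefschetz_complex.finite_face_cells[OF lefschetz_weakly_critical_complex])
    show "incidence W \<tau> \<sigma> = 0"
      if "\<tau> \<in> k_cells W k" "\<sigma> \<in> face_cells W k - (\<Union>r\<in>I. ?S r)" for \<tau> \<sigma>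
      using that assms(2) by (auto simp: k_cells_def face_cells_def)
  qed (auto simp: face_cells_def)
  also have "\<dots> = (\<Sum>r\<in>I. submatrix_rank (incidence W) (?R r) (?S r))"
    unfolding rows using assms(1) fin
    by (intro submatrix_rank_block_diagonal) (auto simp: k_cells_def face_cells_def)
  also have "\<dots> = (\<Sum>r\<in>I. boundary_rank (critical_level r) k)"
    unfolding boundary_rank_def
    by (intro sum.cong refl submatrix_rank_cong) (auto simp: k_cells_def face_cells_def)
  finally show ?thesis .
qed

text \<open>
  The block of level \<open>r\<close> has as rows the weakly critical \<open>k\<close>-cells and the upper cells of value \<open>r\<close>,
  and as columns the weakly critical \<open>(k-1)\<close>-cells of value \<open>r\<close> and the partners of these upper cells,
  although \<open>f\<close> is larger than \<open>r\<close> on the partners.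
\<close>

lemma boundary_rank_ge: "d_snc K f k + boundary_rank W k \<le> boundary_rank K k"
proof -
  define I where "I = f ` k_cells K k"
  let ?w = "incidence K"
  let ?C = "\<lambda>r. k_cells (critical_level r) k" and ?C' = "\<lambda>r. face_cells (critical_level r) k"
  let ?A = "\<lambda>r. {\<sigma> \<in> upper_cells k. f \<sigma> = r}"
  let ?R = "\<lambda>r. ?C r \<union> ?A r" and ?S = "\<lambda>r. ?C' r \<union> partner ` ?A r"
  have finI: "finite I" unfolding I_def using finite_k_cells by blast
  have finA: "finite (?A r)" for r
    using finite_k_cells by (auto simp: upper_cells_def)
  have finC: "finite (?C r)" "finite (?C' r)" for r
    using lefschetz_complex.finite_k_cells[OF lefschetz_critical_level]
      lefschetz_complex.finite_face_cells[OF lefschetz_critical_level] by auto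
  have A: "\<sigma> \<in> cells K \<and> D_snc K f \<sigma> = 1 \<and> f \<sigma> = r" if "\<sigma> \<in> ?A r" for \<sigma> r
    using that by (auto simp: upper_cells_def k_cells_def)
  have C: "\<sigma> \<in> cells K \<and> D_snc K f \<sigma> = 0 \<and> U_snc K f \<sigma> = 0 \<and> f \<sigma> = r" if "\<sigma> \<in> ?C r \<or> \<sigma> \<in> ?C' r" for \<sigma> r
    using that by (auto simp: k_cells_def face_cells_def weakly_critical_def)
  \<comment> \<open>In one level the weakly critical rows vanish on the partner columns, whereas the upper rows may meet the weakly critical columns.\<close>
  have block: "card (?A r) + boundary_rank (critical_level r) k \<le> submatrix_rank ?w (?R r) (?S r)" for r
  proof -
    have "submatrix_rank ?w (?A r) (partner ` ?A r) = card (?A r)"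
    proof (rule submatrix_rank_diagonal[OF finA])
      show "?w a (partner a) \<noteq> 0" if "a \<in> ?A r" for a
        using partner(2)[of a] A[OF that] by blast
      show "?w a (partner b) = 0" if "a \<in> ?A r" "b \<in> ?A r" "a \<noteq> b" for a b
        using incidence_partner[of b a] A[OF that(1)] A[OF that(2)] that(3) by force
    qed
    moreover have "submatrix_rank ?w (?C r) (?C' r) + submatrix_rank ?w (?A r) (partner ` ?A r)
        \<le> submatrix_rank ?w (?R r) (?S r)"
    proof (rule submatrix_rank_triangular)
      fix \<tau> \<nu> assume \<tau>: "\<tau> \<in> ?C r" and "\<nu> \<in> partner ` ?A r"
      then obtain a where a: "a \<in> ?A r" "\<nu> = partner a" by blast
      show "?w \<tau> \<nu> = 0"
        using incidence_partner[of a \<tau>] A[OF a(1)] C[of \<tau> r] \<tau> a(2) by force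
    qed (use finA finC in auto)
    ultimately show ?thesis by (simp add: boundary_rank_def)
  qed
  have "d_snc K f k + boundary_rank W k = (\<Sum>r\<in>I. card (?A r)) + (\<Sum>r\<in>I. boundary_rank (critical_level r) k)"
  proof -
    have "upper_cells k = (\<Union>r\<in>I. ?A r)" by (auto simp: I_def upper_cells_def)
    moreover have "card (\<Union>r\<in>I. ?A r) = (\<Sum>r\<in>I. card (?A r))"
      using finI finA by (intro card_UN_disjoint) auto
    moreover have "boundary_rank W k = (\<Sum>r\<in>I. boundary_rank (critical_level r) k)"
      using finI weakly_critical_subset
      by (intro boundary_rank_weakly_critical_complex) (auto simp: I_def k_cells_def)
    ultimately show ?thesis by (simp flip: card_upper_cells)
  qed
  also have "\<dots> \<le> (\<Sum>r\<in>I. submatrix_rank ?w (?R r) (?S r))"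
    using block by (simp add: sum_mono flip: sum.distrib)
  also have "\<dots> \<le> submatrix_rank ?w (\<Union>r\<in>I. ?R r) (\<Union>r\<in>I. ?S r)"
  proof (rule submatrix_rank_block_triangular[OF finI])
    fix i j \<tau> \<nu> assume ij: "i < j" and \<tau>: "\<tau> \<in> ?R i" and \<nu>: "\<nu> \<in> ?S j"
    have \<tau>': "\<tau> \<in> cells K" "f \<tau> = i" using \<tau> A C by blast+
    from \<nu> consider "\<nu> \<in> ?C' j" | a where "a \<in> ?A j" "\<nu> = partner a" by blast
    then show "?w \<tau> \<nu> = 0"
    proof cases
      case 1
      then show ?thesis using C[of \<nu> j] U_snc_eq_0_iff[of \<nu>] \<tau>' ij by force
    next
      case 2
      then show ?thesis using incidence_partner[of a \<tau>] A[of a j] \<tau>' ij by force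
    qed
  qed (use finA finC in auto)
  also have "\<dots> \<le> boundary_rank K k"
    unfolding boundary_rank_def
  proof (rule submatrix_rank_mono[OF finite_k_cells finite_face_cells])
    show "(\<Union>r\<in>I. ?R r) \<subseteq> k_cells K k"
      using weakly_critical_subset by (auto simp: k_cells_def upper_cells_def)
    have "partner \<sigma> \<in> face_cells K k" if "\<sigma> \<in> upper_cells k" for \<sigma>
      using that partner[of \<sigma>] incidence_dim[of \<sigma> "partner \<sigma>"]
      by (auto simp: upper_cells_def k_cells_def face_cells_def)
    then show "(\<Union>r\<in>I. ?S r) \<subseteq> face_cells K k"
      using weakly_critical_subset by (auto simp: face_cells_def)
  qed
  finally show ?thesis .
qed


section \<open>Poincare series\<close>

lemma betti_weakly_critical_complex:
  assumes I: "finite I" "f ` (k_cells W k \<union> k_cells W (k + 1)) \<subseteq> I"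
  shows "betti W k = (\<Sum>r\<in>I. betti (critical_level r) k)"
proof -
  have "k_cells W k = (\<Union>r\<in>I. k_cells (critical_level r) k)"
    using I(2) by (auto simp: k_cells_def)
  moreover have "card (\<Union>r\<in>I. k_cells (critical_level r) k) = (\<Sum>r\<in>I. card (k_cells (critical_level r) k))"
    using I(1) lefschetz_complex.finite_k_cells[OF lefschetz_critical_level]
    by (intro card_UN_disjoint) (auto simp: k_cells_def)
  ultimately have "card (k_cells W k) = (\<Sum>r\<in>I. card (k_cells (critical_level r) k))" by simp
  also have "\<dots> = (\<Sum>r\<in>I. betti (critical_level r) k + boundary_rank (critical_level r) k
      + boundary_rank (critical_level r) (k + 1))"
    by (simp only: lefschetz_complex.betti_plus_ranks[OF lefschetz_critical_level])
  also have "\<dots> = (\<Sum>r\<in>I. betti (critical_level r) k) + boundary_rank W k + boundary_rank W (k + 1)"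
    using I by (simp add: sum.distrib boundary_rank_weakly_critical_complex[OF I(1)] image_Un)
  finally show ?thesis
    using lefschetz_complex.betti_plus_ranks[OF lefschetz_weakly_critical_complex, of k] by simp
qed

text \<open>
  The weakly critical sets are parametrised by the levels, injectively where they are
  nonempty; this turns the sum over \<open>C\<close> into a sum over values of \<open>f\<close>.
\<close>

lemma mem_weakly_critical_sets_iff:
  "C \<in> weakly_critical_sets K f \<longleftrightarrow> C \<noteq> {} \<and> (\<exists>r. C = {\<sigma> \<in> weakly_critical. f \<sigma> = r})"
proof -
  have *: "weakly_critical_set K f {\<sigma> \<in> cells K. f \<sigma> = r} = {\<sigma> \<in> weakly_critical. f \<sigma> = r}" for r
    by (auto simp: weakly_critical_set_def weakly_critical_def)
  show ?thesis
  proof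
    assume "C \<in> weakly_critical_sets K f"
    then show "C \<noteq> {} \<and> (\<exists>r. C = {\<sigma> \<in> weakly_critical. f \<sigma> = r})"
      using * by (auto simp: weakly_critical_sets_def level_sets_def)
  next
    assume "C \<noteq> {} \<and> (\<exists>r. C = {\<sigma> \<in> weakly_critical. f \<sigma> = r})"
    then obtain r where r: "C \<noteq> {}" "C = {\<sigma> \<in> weakly_critical. f \<sigma> = r}" by blast
    have "{\<sigma> \<in> cells K. f \<sigma> = r} \<in> level_sets K f"
      using r weakly_critical_subset by (auto simp: level_sets_def)
    then have "C \<in> weakly_critical_set K f ` level_sets K f"
      unfolding r(2) *[of r, symmetric] by (rule imageI)
    with r(1) show "C \<in> weakly_critical_sets K f"
      by (simp add: weakly_critical_sets_def)
  qed
qed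

text \<open>
  In degree \<open>k\<close> only levels that carry weakly critical \<open>k\<close>-cells contribute, but additivity of the
  Betti numbers also needs the levels of the \<open>(k+1)\<close>-cells, whence the two index sets \<open>J \<subseteq> I\<close>.
\<close>

lemma has_sum_poincare_series:
  "((\<lambda>C. poincare_series (restrict_cells K C)) has_sum poincare_series W) (weakly_critical_sets K f)"
proof -
  let ?C = "\<lambda>r. {\<sigma> \<in> weakly_critical. f \<sigma> = r}"
  define F where "F C = poincare_series (restrict_cells K C)" for C
  have F: "fps_nth (F (?C r)) k = int (betti (critical_level r) k)" for r k
    by (simp add: F_def poincare_series_def critical_level_def)
  have main: "finite {C \<in> weakly_critical_sets K f. fps_nth (F C) k \<noteq> 0} \<and>
    fps_nth (poincare_series W) k =
      (\<Sum>C | C \<in> weakly_critical_sets K f \<and> fps_nth (F C) k \<noteq> 0. fps_nth (F C) k)" for k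
  proof -
    define J where "J = f ` k_cells W k"
    define I where "I = f ` (k_cells W k \<union> k_cells W (k + 1))"
    have fin: "finite I" "finite J" and JI: "J \<subseteq> I"
      using lefschetz_complex.finite_k_cells[OF lefschetz_weakly_critical_complex]
      by (auto simp: I_def J_def)
    have zero: "betti (critical_level r) k = 0" if "r \<notin> J" for r
    proof -
      have "k_cells (critical_level r) k = {}" using that by (auto simp: J_def k_cells_def)
      then show ?thesis
        using lefschetz_complex.betti_plus_ranks[OF lefschetz_critical_level, of r k] by simp
    qed
    have nonempty: "?C r \<noteq> {}" if "r \<in> J" for r
      using that by (auto simp: J_def k_cells_def)
    have inj: "inj_on ?C J"
      using nonempty by (intro inj_onI) blast
    have sub: "{C \<in> weakly_critical_sets K f. fps_nth (F C) k \<noteq> 0} \<subseteq> ?C ` J"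
    proof
      fix C assume "C \<in> {C \<in> weakly_critical_sets K f. fps_nth (F C) k \<noteq> 0}"
      then obtain r where "C = ?C r" "fps_nth (F (?C r)) k \<noteq> 0"
        unfolding mem_weakly_critical_sets_iff by blast
      with zero[of r] show "C \<in> ?C ` J" unfolding F by auto
    qed
    have "fps_nth (poincare_series W) k = int (\<Sum>r\<in>I. betti (critical_level r) k)"
      using betti_weakly_critical_complex[OF fin(1), of k] by (simp add: poincare_series_def I_def)
    also have "(\<Sum>r\<in>I. betti (critical_level r) k) = (\<Sum>r\<in>J. betti (critical_level r) k)"
      using fin JI zero by (intro sum.mono_neutral_right) auto
    also have "int \<dots> = (\<Sum>C\<in>?C ` J. fps_nth (F C) k)"
      by (simp add: sum.reindex[OF inj] F)
    also have "\<dots> = (\<Sum>C | C \<in> weakly_critical_sets K f \<and> fps_nth (F C) k \<noteq> 0. fps_nth (F C) k)"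
    proof (rule sum.mono_neutral_right)
      have "?C ` J \<subseteq> weakly_critical_sets K f"
        using nonempty unfolding mem_weakly_critical_sets_iff image_subset_iff by blast
      then show "\<forall>C\<in>?C ` J - {C \<in> weakly_critical_sets K f. fps_nth (F C) k \<noteq> 0}. fps_nth (F C) k = 0"
        by blast
    qed (use fin sub in auto)
    finally show ?thesis using finite_subset[OF sub] fin by simp
  qed
  have "(F has_sum poincare_series W) (weakly_critical_sets K f)"
    by (rule has_sum_fpsI) (use main in auto)
  then show ?thesis by (simp add: F_def[abs_def])
qed

lemma remainder_series_nth:
  "fps_nth (remainder_series K f) j =
    int (boundary_rank K (j + 1)) - int (d_snc K f (j + 1)) - int (boundary_rank W (j + 1))"
  by (simp add: remainder_series_def dim_boundaries
      lefschetz_complex.dim_boundaries[OF lefschetz_weakly_critical_complex])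

text \<open>
  In degree \<open>k\<close> the series \<open>(1 + t) R\<^sub>t\<close> contributes the remainder terms of the boundary maps on
  \<open>k\<close>- and on \<open>(k+1)\<close>-chains. Both reduce to differences of ranks and numbers of pairs, which cancel
  against the formulas for the Betti numbers.
\<close>

lemma poincare_series_weakly_critical_complex:
  "poincare_series W = poincare_series K + (1 + fps_X) * remainder_series K f"
proof (rule fps_ext)
  fix k
  \<comment> \<open>The coefficient of \<open>t\<^sup>j\<close> in the remainder belongs to dimension \<open>j + 1\<close>; for \<open>k = 0\<close> the missing term agrees with the rank expression, as all three of its summands vanish.\<close>
  have "fps_nth ((1 + fps_X) * remainder_series K f) k =
      fps_nth (remainder_series K f) k + (if k = 0 then 0 else fps_nth (remainder_series K f) (k - 1))"
    by (simp add: distrib_right)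
  moreover have "(if k = 0 then 0 else fps_nth (remainder_series K f) (k - 1)) =
      int (boundary_rank K k) - int (d_snc K f k) - int (boundary_rank W k)"
    using boundary_rank_ge[of 0] by (cases k) (auto simp: remainder_series_nth)
  moreover note betti_plus_ranks[of k]
    lefschetz_complex.betti_plus_ranks[OF lefschetz_weakly_critical_complex, of k] card_k_cells[of k]
  ultimately show "fps_nth (poincare_series W) k =
      fps_nth (poincare_series K + (1 + fps_X) * remainder_series K f) k"
    by (simp add: poincare_series_def remainder_series_nth)
qed

end

theorem theorem1p1:
  fixes K :: "'a lefschetz" and f :: "'a \<Rightarrow> real"
  assumes "lefschetz_complex K"
    and "discrete_morse_bott K f"
  shows "(\<forall>k. fps_nth (remainder_series K f) k \<ge> 0) \<and>
    ((\<lambda>C. poincare_series (restrict_cells K C))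
       has_sum (poincare_series K + (1 + fps_X) * remainder_series K f))
      (weakly_critical_sets K f)"
proof -
  interpret morse_bott K f
    using assms by (simp add: morse_bott_def morse_bott_axioms_def)
  have "fps_nth (remainder_series K f) k \<ge> 0" for k
    using boundary_rank_ge[of "k + 1"] by (simp add: remainder_series_nth)
  then show ?thesis
    using has_sum_poincare_series by (simp add: poincare_series_weakly_critical_complex)
qed

end
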